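(* A subset $K$ of $\mathcal L^1_E$ is relatively norm compact if and only if the following three conditions hold: (1) $K$ is relatively weakly compact in $\mathcal L^1_E$; (2) $K$ satisfies the Bocce criterion; (3) for each $B\in\mathcal F^+$, the set $\Delta_B:=\{m_B(f): f\in K\}$ is relatively norm compact in $E$. Moreover, the equivalence remains valid if condition (1) is replaced by (1') $K$ is relatively compact in the $\sigma(\mathcal L^1_E,\mathcal L^\infty_{E^*})$-topology.
   Context: $(E,\|\cdot\|)$ is a Banach space with dual $E^*$, and $(\Omega,\mathcal F,\mu)$ is a probability space. $\mathcal F^+$ is the collection of sets in $\mathcal F$ with strictly positive measure, and for $B\in\mathcal F$, $\mathcal F^+(B)$ is the collection of measurable subsets of $B$ with strictly positive measure. $\mathcal L^1_E$ is the (prequotient) space of Bochner $\mu$-integrable functions $f:\Omega\to E$, with (semi)norm $\|f\|_1=\int_\Omega\|f\|\,d\mu$ (functions equal a.e. are identified when speaking of compactness); norm compactness refers to this (semi)norm. The weak topology is the one induced by all continuous linear functionals on $(\mathcal L^1_E,\|\cdot\|_1)$. $\mathcal L^\infty_{E^*}$ is the space of strongly measurable bounded functions $b:\Omega\to E^*$; $\sigma(\mathcal L^1_E,\mathcal L^\infty_{E^*})$ is the topology on $\mathcal L^1_E$ induced by the functionals $f\mapsto\int_\Omega\langle f,b\rangle\,d\mu$, $b\in\mathcal L^\infty_{E^*}$. For $f\in\mathcal L^1_E$ and $A\in\mathcal F$, put $m_A(f):=\frac{1}{\mu(A)}\int_A f\,d\mu$ and $\text{Bocce-osc } f|_A:=\frac{1}{\mu(A)}\int_A\|f-m_A(f)\|\,d\mu$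 (with the convention $0/0=0$). A subset $K$ of $\mathcal L^1_E$ satisfies the Bocce criterion if for each $\epsilon>0$ and each $B\in\mathcal F^+$ there is a finite collection $\mathcal A$ of sets in $\mathcal F^+(B)$ such that for each $f\in K$ there is $A\in\mathcal A$ with $\text{Bocce-osc } f|_A<\epsilon$. *)

theory Defs
  imports "HOL-Probability.Probability"
begin

text \<open>
  The library's \<^const>\<open>integrable\<close> and \<^const>\<open>lebesgue_integral\<close> are restricted to second countable
  (hence separable) spaces. Here \<open>E\<close> is an arbitrary real Banach space, and its dual \<open>'e \<Rightarrow>\<^sub>L real\<close> need not
  be separable either, so the library's definition is repeated with Borel measurability
  replaced by strong measurability. On second countable spaces the two notions agree
  (\<open>has_Bochner_integral_iff\<close> below). Integrals of real functions are taken from the library.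
\<close>

definition strongly_measurable :: "'a measure \<Rightarrow> ('a \<Rightarrow> 'b::real_normed_vector) \<Rightarrow> bool" where
  "strongly_measurable M f \<longleftrightarrow>
     (\<exists>s. (\<forall>n. simple_function M (s n)) \<and> (\<forall>x\<in>space M. (\<lambda>n. s n x) \<longlonglongrightarrow> f x))"

definition has_Bochner_integral ::
    "'a measure \<Rightarrow> ('a \<Rightarrow> 'b::real_normed_vector) \<Rightarrow> 'b \<Rightarrow> bool" where
  "has_Bochner_integral M f I \<longleftrightarrow> strongly_measurable M f \<and>
     (\<exists>s. (\<forall>n. Bochner_Integration.simple_bochner_integrable M (s n)) \<and>
          (\<lambda>n. \<integral>\<^sup>+x. ennreal (norm (f x - s n x)) \<partial>M) \<longlonglongrightarrow> 0 \<and>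
          (\<lambda>n. Bochner_Integration.simple_bochner_integral M (s n)) \<longlonglongrightarrow> I)"

definition Bochner_integrable :: "'a measure \<Rightarrow> ('a \<Rightarrow> 'b::real_normed_vector) \<Rightarrow> bool" where
  "Bochner_integrable M f \<longleftrightarrow> (\<exists>I. has_Bochner_integral M f I)"

definition Bochner_integral :: "'a measure \<Rightarrow> ('a \<Rightarrow> 'b::real_normed_vector) \<Rightarrow> 'b" where
  "Bochner_integral M f = (THE I. has_Bochner_integral M f I)"

lemma strongly_measurable_iff_borel:
  fixes f :: "'a \<Rightarrow> 'b::{real_normed_vector, second_countable_topology}"
  shows "strongly_measurable M f \<longleftrightarrow> f \<in> borel_measurable M"
proof
  assume "strongly_measurable M f"
  then obtain s where s: "\<And>n. simple_function M (s n)"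
    "\<And>x. x \<in> space M \<Longrightarrow> (\<lambda>n. s n x) \<longlonglongrightarrow> f x"
    unfolding strongly_measurable_def by blast
  show "f \<in> borel_measurable M"
    by (rule borel_measurable_LIMSEQ_metric[OF borel_measurable_simple_function[OF s(1)] s(2)])
next
  assume "f \<in> borel_measurable M"
  from borel_measurable_implies_sequence_metric[OF this, of 0]
  show "strongly_measurable M f"
    unfolding strongly_measurable_def by blast
qed

lemma has_Bochner_integral_iff:
  fixes f :: "'a \<Rightarrow> 'b::{real_normed_vector, second_countable_topology}"
  shows "has_Bochner_integral M f I \<longleftrightarrow> has_bochner_integral M f I"
  unfolding has_Bochner_integral_def has_bochner_integral.simps strongly_measurable_iff_borel
  by auto

lemma has_Bochner_integral_unique:
  assumes "has_Bochner_integral M f I" "has_Bochner_integral M f J"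
  shows "I = J"
proof -
  from assms obtain s t where
    s: "\<And>n. Bochner_Integration.simple_bochner_integrable M (s n)"
       "(\<lambda>n. \<integral>\<^sup>+x. ennreal (norm (f x - s n x)) \<partial>M) \<longlonglongrightarrow> 0"
       "(\<lambda>n. Bochner_Integration.simple_bochner_integral M (s n)) \<longlonglongrightarrow> I" and
    t: "\<And>n. Bochner_Integration.simple_bochner_integrable M (t n)"
       "(\<lambda>n. \<integral>\<^sup>+x. ennreal (norm (f x - t n x)) \<partial>M) \<longlonglongrightarrow> 0"
       "(\<lambda>n. Bochner_Integration.simple_bochner_integral M (t n)) \<longlonglongrightarrow> J"
    and sm: "strongly_measurable M f"
    unfolding has_Bochner_integral_def by blast
  have meas: "(\<lambda>x. norm (f x - g x)) \<in> borel_measurable M"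
    if "Bochner_Integration.simple_bochner_integrable M g" for g
  proof -
    from that have g: "simple_function M g" by (auto elim: simple_bochner_integrable.cases)
    from sm obtain u where u: "\<And>n. simple_function M (u n)"
      "\<And>x. x \<in> space M \<Longrightarrow> (\<lambda>n. u n x) \<longlonglongrightarrow> f x" unfolding strongly_measurable_def by blast
    show ?thesis
    proof (rule borel_measurable_LIMSEQ_metric)
      show "(\<lambda>x. norm (u n x - g x)) \<in> borel_measurable M" for n
        using u(1) g
        by (intro borel_measurable_simple_function
            simple_function_compose2[where h = "\<lambda>a b. norm (a - b)"])
      show "(\<lambda>n. norm (u n x - g x)) \<longlonglongrightarrow> norm (f x - g x)" if "x \<in> space M" for x
        using u(2)[OF that] by (intro tendsto_intros)
    qed
  qed
  let ?S = "\<lambda>n. \<integral>\<^sup>+x. ennreal (norm (f x - s n x)) \<partial>M"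
  let ?T = "\<lambda>n. \<integral>\<^sup>+x. ennreal (norm (f x - t n x)) \<partial>M"
  let ?d = "\<lambda>n. norm (Bochner_Integration.simple_bochner_integral M (s n) - Bochner_Integration.simple_bochner_integral M (t n))"
  have le: "ennreal (?d n) \<le> ?S n + ?T n" for n
  proof -
    have st: "Bochner_Integration.simple_bochner_integrable M (\<lambda>x. s n x - t n x)"
      by (rule simple_bochner_integrable_compose2[where p = "\<lambda>a b. a - b", OF _ s(1) t(1)]) simp
    have nst: "Bochner_Integration.simple_bochner_integrable M (\<lambda>x. norm (s n x - t n x))"
      by (rule simple_bochner_integrable_compose2[where p = "\<lambda>a b. norm (a - b)", OF _ s(1) t(1)])
        simp
    have "ennreal (?d n) \<le> ennreal (Bochner_Integration.simple_bochner_integral M (\<lambda>x. norm (s n x - t n x)))"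
      using simple_bochner_integral_norm_bound[OF st] s(1) t(1)
      by (simp add: simple_bochner_integral_diff ennreal_leI)
    also have "\<dots> = (\<integral>\<^sup>+x. ennreal (norm (s n x - t n x)) \<partial>M)"
      using nst by (intro simple_bochner_integral_eq_nn_integral) auto
    also have "\<dots> \<le> (\<integral>\<^sup>+x. ennreal (norm (f x - s n x)) + ennreal (norm (f x - t n x)) \<partial>M)"
    proof (intro nn_integral_mono)
      fix x
      have "norm (s n x - t n x) \<le> norm (f x - s n x) + norm (f x - t n x)"
        using norm_triangle_ineq4[of "f x - t n x" "f x - s n x"] by (simp add: algebra_simps)
      then show "ennreal (norm (s n x - t n x))
          \<le> ennreal (norm (f x - s n x)) + ennreal (norm (f x - t n x))"
        by (metis ennreal_leI ennreal_plus norm_ge_zero)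
    qed
    also have "\<dots> = ?S n + ?T n"
      using meas[OF s(1)[of n]] meas[OF t(1)[of n]] by (intro nn_integral_add) auto
    finally show ?thesis .
  qed
  have "(\<lambda>n. ennreal (?d n)) \<longlonglongrightarrow> ennreal 0"
  proof (rule tendsto_sandwich[where f = "\<lambda>_. 0" and h = "\<lambda>n. ?S n + ?T n"])
    show "(\<lambda>n. ?S n + ?T n) \<longlonglongrightarrow> ennreal 0"
      using tendsto_add[OF s(2) t(2)] by simp
  qed (use le in auto)
  then have "?d \<longlonglongrightarrow> 0" by (simp flip: ennreal_0)
  moreover have "?d \<longlonglongrightarrow> norm (I - J)"
    using s(3) t(3) by (intro tendsto_intros)
  ultimately have "norm (I - J) = 0" using LIMSEQ_unique by blast
  then show ?thesis by simp
qed


text \<open>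
  The prequotient space: functions are not identified. Its topologies below do not separate
  functions that are equal almost everywhere, so that compactness in them is the same as
  compactness after the identification.
\<close>

definition L1_space :: "'a measure \<Rightarrow> ('a \<Rightarrow> 'e::banach) set" where
  "L1_space M = {f. Bochner_integrable M f}"

definition L1_norm :: "'a measure \<Rightarrow> ('a \<Rightarrow> 'e::banach) \<Rightarrow> real" where
  "L1_norm M f = (LINT x|M. norm (f x))"

definition L1_norm_topology :: "'a measure \<Rightarrow> ('a \<Rightarrow> 'e::banach) topology" where
  "L1_norm_topology M = topology_generated_by
     {{g \<in> L1_space M. L1_norm M (\<lambda>x. g x - f x) < r} | f r. f \<in> L1_space M \<and> 0 < r}"

text \<open>Only the values of a functional on \<^const>\<open>L1_space\<close> matter; outside they are arbitrary.\<close>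

definition L1_dual :: "'a measure \<Rightarrow> (('a \<Rightarrow> 'e::banach) \<Rightarrow> real) set" where
  "L1_dual M = {\<phi>.
     (\<forall>f\<in>L1_space M. \<forall>g\<in>L1_space M. \<phi> (\<lambda>x. f x + g x) = \<phi> f + \<phi> g) \<and>
     (\<forall>c. \<forall>f\<in>L1_space M. \<phi> (\<lambda>x. c *\<^sub>R f x) = c * \<phi> f) \<and>
     continuous_map (L1_norm_topology M) euclideanreal \<phi>}"

definition Linf_dual :: "'a measure \<Rightarrow> ('a \<Rightarrow> ('e::banach \<Rightarrow>\<^sub>L real)) set" where
  "Linf_dual M = {b. strongly_measurable M b \<and> (\<exists>C. \<forall>x\<in>space M. norm (b x) \<le> C)}"

text \<open>The coarsest topology on \<open>S\<close> making all (restrictions of) functionals in \<open>\<Phi>\<close> continuous.\<close>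

definition induced_topology :: "'b set \<Rightarrow> ('b \<Rightarrow> real) set \<Rightarrow> 'b topology" where
  "induced_topology S \<Phi> = topology_generated_by {{f \<in> S. \<phi> f \<in> U} | \<phi> U. \<phi> \<in> \<Phi> \<and> open U}"

definition L1_weak_topology :: "'a measure \<Rightarrow> ('a \<Rightarrow> 'e::banach) topology" where
  "L1_weak_topology M = induced_topology (L1_space M) (L1_dual M)"

definition L1_sigma_topology :: "'a measure \<Rightarrow> ('a \<Rightarrow> 'e::banach) topology" where
  "L1_sigma_topology M = induced_topology (L1_space M)
     {\<lambda>f. LINT x|M. blinfun_apply (b x) (f x) | b. b \<in> Linf_dual M}"

definition relatively_compactin :: "'b topology \<Rightarrow> 'b set \<Rightarrow> bool" where
  "relatively_compactin X K \<longleftrightarrow> K \<subseteq> topspace X \<and> compactin X (X closure_of K)"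


definition positive_sets :: "'a measure \<Rightarrow> 'a set \<Rightarrow> 'a set set" where
  "positive_sets M B = {A \<in> sets M. A \<subseteq> B \<and> 0 < measure M A}"

definition mean_on :: "'a measure \<Rightarrow> 'a set \<Rightarrow> ('a \<Rightarrow> 'e::banach) \<Rightarrow> 'e" where
  "mean_on M A f = (1 / measure M A) *\<^sub>R Bochner_integral M (\<lambda>x. indicator A x *\<^sub>R f x)"

definition Bocce_osc :: "'a measure \<Rightarrow> ('a \<Rightarrow> 'e::banach) \<Rightarrow> 'a set \<Rightarrow> real" where
  "Bocce_osc M f A = (1 / measure M A) * (LINT x:A|M. norm (f x - mean_on M A f))"

definition Bocce_criterion :: "'a measure \<Rightarrow> ('a \<Rightarrow> 'e::banach) set \<Rightarrow> bool" where
  "Bocce_criterion M K \<longleftrightarrow>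
     (\<forall>\<epsilon>>0. \<forall>B\<in>positive_sets M (space M).
        \<exists>\<A>. finite \<A> \<and> \<A> \<subseteq> positive_sets M B \<and> (\<forall>f\<in>K. \<exists>A\<in>\<A>. Bocce_osc M f A < \<epsilon>))"

end

theory Submission
  imports Defs
begin

text \<open>
  For sufficiency, \<open>\<sigma>(L\<^sup>1, L\<^sup>\<infinity>)\<close>-compactness is used only to see that the functions of \<open>K\<close>
  are uniformly small on a sequence of sets decreasing to a null set: otherwise there are
  \<open>f\<^sub>j \<in> K\<close> with a fixed amount of mass on disjoint sets \<open>D\<^sub>j\<close>, and pairing with norming functionals
  supported on the \<open>D\<^sub>j\<close> maps \<open>K\<close> to sequences in \<open>\<ell>\<^sup>1\<close>, where a gliding hump contradicts weak compactness.

  Now let \<open>U\<close> be an ultrafilter on \<open>K\<close>. By the Bocce criterion every positive set contains a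
  positive set on which \<open>U\<close>-almost all \<open>f\<close> oscillate by less than \<open>\<epsilon>\<close>; exhausting \<open>\<Omega>\<close> by such sets, and using
  that the means over each of them are near one point \<open>U\<close>-eventually, one finds a simple function
  within \<open>\<epsilon>\<close> of \<open>U\<close>-almost all \<open>f\<close>. So \<open>K\<close> is totally bounded, and \<open>L\<^sup>1\<close> is complete.

  For the Bocce criterion of a compact \<open>K\<close>, let \<open>h\<close> be a simple function with \<open>\<parallel>f - h\<parallel>\<^sub>1 < \<epsilon>\<mu>(B)/2\<close>. If \<open>f\<close> had oscillation at least
  \<open>\<epsilon>\<close> on each positive set \<open>B \<inter> {h = v}\<close>, adding up would give \<open>\<parallel>f - h\<parallel>\<^sub>1 \<ge> \<epsilon>\<mu>(B)/2\<close>.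
\<close>

section \<open>Norming functionals\<close>

text \<open>The two equivalences close one cycle: norm compactness gives weak compactness, this
  gives \<open>\<sigma>\<close>-compactness, and with (2) and (3) norm compactness returns. Since
  functions are not identified, none of the topologies need be Hausdorff: compact sets need not be
  closed, and the closure of \<open>K\<close> can grow in a coarser topology. Regularity, which
  every topology induced by functionals has, makes up for this.

  The Bocce criterion offers each \<open>f\<close> one of finitely many sets, and different
  \<open>f\<close> may need different ones. Repeating this inside the remaining set would branch at
  each stage. An ultrafilter settles each choice for almost all \<open>f\<close> at once, so a
  single decreasing sequence of sets suffices.

  Choosing a norming functional for each value of a measurable function raises the question of
  measurability. Here it is chosen only for the finitely many values of a simple function close to
  the given one; the error is paid in the L1 seminorm. Simple functions also serve as centres of all
  finite nets, so completeness is only needed for sequences of them.\<close>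

definition sublinear :: "('e::real_normed_vector \<Rightarrow> real) \<Rightarrow> bool" where
  "sublinear p \<longleftrightarrow> (\<forall>x y. p (x + y) \<le> p x + p y) \<and> (\<forall>c>0. \<forall>x. p (c *\<^sub>R x) \<le> c * p x) \<and> (\<forall>x. p x \<le> norm x)"

lemma sublinear_norm: "sublinear norm"
  by (simp add: sublinear_def norm_triangle_ineq)

lemma sublinear_zero:
  assumes "sublinear p" shows "p 0 = 0"
proof -
  have "p (0 + 0) \<le> p 0 + p 0" "p 0 \<le> norm (0::'a)"
    using assms unfolding sublinear_def by blast+
  then show ?thesis by simp
qed

text \<open>Scaling back by \<open>inverse c\<close> turns the assumed inequality into its converse,
  which is why the definition asks for an inequality.\<close>

lemma sublinear_scale:
  assumes "sublinear p" "0 \<le> c" shows "p (c *\<^sub>R x) = c * p x"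
proof (cases "c = 0")
  case True
  then show ?thesis using sublinear_zero[OF assms(1)] by simp
next
  case False
  then have c: "c > 0" using assms(2) by simp
  have "p (c *\<^sub>R x) \<le> c * p x" using assms(1) c unfolding sublinear_def by blast
  moreover have "p (inverse c *\<^sub>R c *\<^sub>R x) \<le> inverse c * p (c *\<^sub>R x)"
    using assms(1) c unfolding sublinear_def by (metis inverse_positive_iff_positive)
  then have "c * p x \<le> p (c *\<^sub>R x)" using c by (simp add: field_simps)
  ultimately show ?thesis by simp
qed

lemma sublinear_minus:
  assumes "sublinear p" shows "- p (- x) \<le> p x"
proof -
  have "p (x + - x) \<le> p x + p (- x)" using assms unfolding sublinear_def by blast
  then show ?thesis using sublinear_zero[OF assms] by simp
qed

text \<open>This decrease of \<open>p\<close> at \<open>- x\<close> is what replaces the one-dimensional extension step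
  of the usual proof of the Hahn--Banach theorem.\<close>

lemma sublinear_decrease:
  fixes p :: "'e::real_normed_vector \<Rightarrow> real"
  assumes p: "sublinear p"
  obtains q where "sublinear q" "\<And>y. q y \<le> p y" "q (- x) \<le> - p x"
proof -
  \<comment> \<open>This is the largest sublinear functional below \<open>p\<close> with value at
    most \<open>- p x\<close> at \<open>- x\<close>: any such \<open>r\<close> satisfies
    \<open>r y \<le> r (y + t *\<^sub>R x) + t * r (- x)\<close>, and the infimum collects the
    bounds that follow.\<close>
  define q where "q y = (INF t\<in>{0..}. p (y + t *\<^sub>R x) - t * p x)" for y
  have add: "p (y + z) \<le> p y + p z" for y z using p unfolding sublinear_def by blast
  have bdd: "bdd_below ((\<lambda>t. p (y + t *\<^sub>R x) - t * p x) ` {0..})" for y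
  proof (rule bdd_belowI2)
    fix t :: real assume "t \<in> {0..}"
    then show "- p (- y) \<le> p (y + t *\<^sub>R x) - t * p x"
      using add[of "- y" "y + t *\<^sub>R x"] sublinear_scale[OF p, of t x] by simp
  qed
  have le: "q y \<le> p (y + t *\<^sub>R x) - t * p x" if "t \<ge> 0" for y t
    unfolding q_def using that by (intro cINF_lower bdd) auto
  have ge: "c \<le> q y" if "\<And>t. t \<ge> 0 \<Longrightarrow> c \<le> p (y + t *\<^sub>R x) - t * p x" for c y
    unfolding q_def using that by (intro cINF_greatest) auto
  have qp: "q y \<le> p y" for y using le[of 0 y] by simp
  have "sublinear q"
    unfolding sublinear_def
  proof (intro conjI allI impI)
    fix y z
    have "q (y + z) - (p (z + s *\<^sub>R x) - s * p x) \<le> q y" if s: "s \<ge> 0" for s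
    proof (rule ge)
      fix t :: real assume t: "t \<ge> 0"
      have "q (y + z) \<le> p ((y + z) + (t + s) *\<^sub>R x) - (t + s) * p x" using s t by (intro le) simp
      also have "(y + z) + (t + s) *\<^sub>R x = (y + t *\<^sub>R x) + (z + s *\<^sub>R x)" by (simp add: algebra_simps)
      finally show "q (y + z) - (p (z + s *\<^sub>R x) - s * p x) \<le> p (y + t *\<^sub>R x) - t * p x"
        using add[of "y + t *\<^sub>R x" "z + s *\<^sub>R x"] by (simp add: algebra_simps)
    qed
    then have "q (y + z) - q y \<le> q z" by (intro ge) (simp add: algebra_simps)
    then show "q (y + z) \<le> q y + q z" by simp
  next
    fix c :: real and y assume c: "c > 0"
    have "q (c *\<^sub>R y) / c \<le> q y"
    proof (rule ge)
      fix t :: real assume t: "t \<ge> 0"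
      have "q (c *\<^sub>R y) \<le> p (c *\<^sub>R y + (c * t) *\<^sub>R x) - (c * t) * p x" using c t by (intro le) simp
      also have "c *\<^sub>R y + (c * t) *\<^sub>R x = c *\<^sub>R (y + t *\<^sub>R x)" by (simp add: algebra_simps)
      also have "p \<dots> = c * p (y + t *\<^sub>R x)" using c by (intro sublinear_scale[OF p]) simp
      finally show "q (c *\<^sub>R y) / c \<le> p (y + t *\<^sub>R x) - t * p x"
        using c by (simp add: field_simps)
    qed
    then show "q (c *\<^sub>R y) \<le> c * q y" using c by (simp add: field_simps)
  next
    fix y show "q y \<le> norm y" using qp[of y] p unfolding sublinear_def by (meson order_trans)
  qed
  moreover have "q (- x) \<le> - p x" using le[of 1 "- x"] sublinear_zero[OF p] by simp
  ultimately show ?thesis using that qp by blast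
qed

text \<open>Zorn's lemma, ordered downwards. Pointwise infima do not preserve subadditivity in
  general, but along a chain they do, because of any two members one lies below both. The bound
  \<open>- norm y\<close> keeps the infima finite.\<close>

lemma sublinear_minimal:
  fixes p :: "'e::real_normed_vector \<Rightarrow> real"
  assumes p: "sublinear p"
  obtains q where "sublinear q" "\<And>y. q y \<le> p y" "\<And>r. sublinear r \<Longrightarrow> (\<And>y. r y \<le> q y) \<Longrightarrow> r = q"
proof -
  define A where "A = {q. sublinear q \<and> q \<le> p}"
  have "\<exists>m\<in>A. \<forall>a\<in>A. m \<ge> a \<longrightarrow> a = m"
  proof (rule predicate_Zorn)
    show "partial_order_on A (relation_of (\<ge>) A)"
      by (rule partial_order_on_relation_ofI) auto
    fix C assume C: "C \<in> Chains (relation_of (\<ge>) A)"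
    show "\<exists>u\<in>A. \<forall>a\<in>C. a \<ge> u"
    proof (cases "C = {}")
      case True
      then show ?thesis using p by (auto simp: A_def)
    next
      case False
      have CA: "\<And>q. q \<in> C \<Longrightarrow> sublinear q \<and> q \<le> p"
        using C by (auto simp: Chains_def relation_of_def A_def)
      have chain: "\<And>q r. q \<in> C \<Longrightarrow> r \<in> C \<Longrightarrow> q \<le> r \<or> r \<le> q"
        using C by (auto simp: Chains_def relation_of_def)
      define u where "u y = (INF q\<in>C. q y)" for y
      have bdd: "bdd_below ((\<lambda>q. q y) ` C)" for y
      proof (rule bdd_belowI2)
        fix q assume "q \<in> C"
        then have "sublinear q" using CA by blast
        then have "q (- y) \<le> norm (- y)" unfolding sublinear_def by blast
        then show "- norm y \<le> q y" using sublinear_minus[OF \<open>sublinear q\<close>, of y] by simp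
      qed
      have le: "u y \<le> q y" if "q \<in> C" for q y
        unfolding u_def using that by (intro cINF_lower bdd) auto
      have ge: "c \<le> u y" if "\<And>q. q \<in> C \<Longrightarrow> c \<le> q y" for c y
        unfolding u_def using that False by (intro cINF_greatest) auto
      obtain q0 where q0: "q0 \<in> C" using False by blast
      have "sublinear u"
        unfolding sublinear_def
      proof (intro conjI allI impI)
        fix y z
        have "u (y + z) - r z \<le> u y" if r: "r \<in> C" for r
        proof (rule ge)
          fix q assume q: "q \<in> C"
          obtain s where s: "s \<in> C" "s \<le> q" "s \<le> r" using chain[OF q r] q r by blast
          have "u (y + z) \<le> s (y + z)" by (rule le[OF s(1)])
          also have "\<dots> \<le> s y + s z" using CA[OF s(1)] unfolding sublinear_def by blast
          also have "\<dots> \<le> q y + r z" using s by (intro add_mono) (auto simp: le_fun_def)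
          finally show "u (y + z) - r z \<le> q y" by simp
        qed
        then have "u (y + z) - u y \<le> u z" by (intro ge) (simp add: algebra_simps)
        then show "u (y + z) \<le> u y + u z" by simp
      next
        fix c :: real and y assume c: "c > 0"
        have "u (c *\<^sub>R y) / c \<le> u y"
        proof (rule ge)
          fix q assume q: "q \<in> C"
          have "u (c *\<^sub>R y) \<le> c * q y"
            using le[OF q, of "c *\<^sub>R y"] sublinear_scale[of q c y] CA[OF q] c by simp
          then show "u (c *\<^sub>R y) / c \<le> q y" using c by (simp add: field_simps)
        qed
        then show "u (c *\<^sub>R y) \<le> c * u y" using c by (simp add: field_simps)
      next
        fix y show "u y \<le> norm y"
          using le[OF q0, of y] CA[OF q0] unfolding sublinear_def by (meson order_trans)
      qed
      moreover have "u \<le> p" using le[OF q0] CA[OF q0] by (auto simp: le_fun_def intro: order_trans)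
      ultimately show ?thesis using le by (auto simp: A_def le_fun_def)
    qed
  qed
  then obtain q where q: "q \<in> A" "\<And>a. a \<in> A \<Longrightarrow> a \<le> q \<Longrightarrow> a = q" by blast
  show ?thesis
  proof (rule that)
    show "sublinear q" "\<And>y. q y \<le> p y" using q(1) by (auto simp: A_def le_fun_def)
    fix r assume r: "sublinear r" "\<And>y. r y \<le> q y"
    then have "r \<in> A" using q(1) by (auto simp: A_def le_fun_def intro: order_trans)
    then show "r = q" using q(2) r(2) by (auto simp: le_fun_def)
  qed
qed

text \<open>A minimal sublinear functional is odd, since decreasing it at \<open>- x\<close> cannot
  change it; an odd subadditive functional is additive. Decreasing the norm at \<open>- v\<close>
  beforehand forces the value at \<open>v\<close> up to \<open>norm v\<close>.\<close>

lemma ex_norming_functional: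
  fixes v :: "'e::real_normed_vector"
  shows "\<exists>\<phi> :: 'e \<Rightarrow>\<^sub>L real. norm \<phi> \<le> 1 \<and> blinfun_apply \<phi> v = norm v"
proof -
  obtain p where p: "sublinear p" "p (- v) \<le> - norm v"
    using sublinear_decrease[OF sublinear_norm, of v] by metis
  obtain q where q: "sublinear q" "\<And>y. q y \<le> p y"
    and min: "\<And>r. sublinear r \<Longrightarrow> (\<And>y. r y \<le> q y) \<Longrightarrow> r = q"
    using sublinear_minimal[OF p(1)] by blast
  have odd: "q (- x) = - q x" for x
  proof -
    obtain r where r: "sublinear r" "\<And>y. r y \<le> q y" "r (- x) \<le> - q x"
      using sublinear_decrease[OF q(1), of x] by metis
    then have "q (- x) \<le> - q x" using min by metis
    then show ?thesis using sublinear_minus[OF q(1), of x] by simp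
  qed
  have sub: "q (x + y) \<le> q x + q y" for x y using q(1) unfolding sublinear_def by blast
  have add: "q (x + y) = q x + q y" for x y
    using sub[of x y] sub[of "- x" "- y"] odd[of "x + y"] odd[of x] odd[of y] by (simp add: add.commute)
  have scale: "q (c *\<^sub>R x) = c * q x" for c x
  proof (cases "c \<ge> 0")
    case True
    then show ?thesis by (rule sublinear_scale[OF q(1)])
  next
    case False
    then show ?thesis
      using sublinear_scale[OF q(1), of "- c" x] odd[of "c *\<^sub>R x"] by simp
  qed
  have bound: "\<bar>q x\<bar> \<le> norm x" for x
  proof -
    have "q x \<le> norm x" "q (- x) \<le> norm (- x)" using q(1) unfolding sublinear_def by blast+
    then show ?thesis using odd[of x] by simp
  qed
  have bl: "bounded_linear q"
    by (rule bounded_linear_intro[where K = 1]) (use add scale bound in auto)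
  have "norm (Blinfun q) \<le> 1"
    by (rule norm_blinfun_bound) (use bound bl in \<open>auto simp: bounded_linear_Blinfun_apply\<close>)
  moreover have "q v = norm v"
  proof -
    have "q (- v) \<le> - norm v" using q(2)[of "- v"] p(2) by linarith
    then have "norm v \<le> q v" using odd[of v] by simp
    then show ?thesis using bound[of v] by simp
  qed
  ultimately show ?thesis using bl by (auto simp: bounded_linear_Blinfun_apply)
qed

section \<open>Ultrafilters and compactness\<close>

definition ultrafilter :: "'a filter \<Rightarrow> bool" where
  "ultrafilter U \<longleftrightarrow> U \<noteq> bot \<and> (\<forall>P. eventually P U \<or> eventually (\<lambda>x. \<not> P x) U)"

text \<open>Smaller filters are finer, so a minimal proper filter is sought. If \<open>P\<close>
  does not fail eventually, restricting \<open>U\<close> to the points satisfying \<open>P\<close>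
  leaves a proper filter, which by minimality is \<open>U\<close> itself.\<close>

lemma ex_ultrafilter_le:
  fixes F :: "'a filter"
  assumes "F \<noteq> bot"
  obtains U where "ultrafilter U" "U \<le> F"
proof -
  define A where "A = {G. G \<noteq> bot \<and> G \<le> F}"
  have "\<exists>m\<in>A. \<forall>a\<in>A. m \<ge> a \<longrightarrow> a = m"
  proof (rule predicate_Zorn)
    show "partial_order_on A (relation_of (\<ge>) A)"
      by (rule partial_order_on_relation_ofI) auto
    fix C assume C: "C \<in> Chains (relation_of (\<ge>) A)"
    show "\<exists>u\<in>A. \<forall>a\<in>C. a \<ge> u"
    proof (cases "C = {}")
      case True
      then show ?thesis using assms by (auto simp: A_def)
    next
      case False
      have CA: "\<And>q. q \<in> C \<Longrightarrow> q \<noteq> bot \<and> q \<le> F"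
        using C by (auto simp: Chains_def relation_of_def A_def)
      have chain: "\<And>q r. q \<in> C \<Longrightarrow> r \<in> C \<Longrightarrow> q \<le> r \<or> r \<le> q"
        using C by (auto simp: Chains_def relation_of_def)
      \<comment> \<open>A chain of filters is a filter base: what holds eventually for the infimum
        already does so for some member, hence the infimum stays proper.\<close>
      have "eventually P (Inf C) \<longleftrightarrow> (\<exists>b\<in>C. eventually P b)" for P
        by (rule eventually_Inf_base[OF False]) (use chain in \<open>metis inf.absorb1 inf.absorb2 order_refl\<close>)
      then have "Inf C \<noteq> bot" using CA by (metis eventually_bot trivial_limit_def)
      moreover have "Inf C \<le> F" using CA False by (metis Inf_lower2 ex_in_conv)
      ultimately show ?thesis by (auto simp: A_def intro: Inf_lower)
    qed
  qed
  then obtain U where U: "U \<noteq> bot" "U \<le> F" "\<And>G. G \<noteq> bot \<Longrightarrow> G \<le> U \<Longrightarrow> G = U"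
    unfolding A_def by (metis (mono_tags, lifting) mem_Collect_eq order_trans)
  have "eventually P U \<or> eventually (\<lambda>x. \<not> P x) U" for P
  proof (cases "inf U (principal {x. P x}) = bot")
    case True
    then have "eventually (\<lambda>_. False) (inf U (principal {x. P x}))" by simp
    then show ?thesis by (simp add: eventually_inf_principal)
  next
    case False
    then have "U = inf U (principal {x. P x})" using U(3) by (metis inf_le1)
    moreover have "eventually P (inf U (principal {x. P x}))" by (simp add: eventually_inf_principal)
    ultimately show ?thesis by simp
  qed
  then show ?thesis using that U unfolding ultrafilter_def by blast
qed

text \<open>The pigeonhole principle by which finitely many alternatives, from the Bocce criterion
  or from a finite net, become one choice valid for almost all points.\<close>

lemma ultrafilter_finite_exD:
  assumes "ultrafilter U" "finite I" "eventually (\<lambda>x. \<exists>i\<in>I. P i x) U"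
  shows "\<exists>i\<in>I. eventually (P i) U"
proof (rule ccontr)
  assume "\<not> ?thesis"
  then have "\<forall>i\<in>I. eventually (\<lambda>x. \<not> P i x) U" using assms(1) unfolding ultrafilter_def by blast
  then have "eventually (\<lambda>x. \<forall>i\<in>I. \<not> P i x) U" using assms(2) by (simp add: eventually_ball_finite)
  with assms(3) have "eventually (\<lambda>x. False) U" by eventually_elim blast
  then show False using assms(1) by (simp add: ultrafilter_def trivial_limit_def)
qed

text \<open>The hypothesis is the finite intersection property of \<open>K\<close> and the
  complements of the members of \<open>\<U>\<close>, so these sets generate a proper filter. With
  open covers this serves compactness, with balls about simple functions total boundedness.\<close>

lemma ultrafilter_disjoint_finite_covers:
  fixes K :: "'a set"
  assumes "\<And>\<F>. finite \<F> \<Longrightarrow> \<F> \<subseteq> \<U> \<Longrightarrow> \<not> K \<subseteq> \<Union>\<F>"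
  obtains U where "ultrafilter U" "eventually (\<lambda>x. x \<in> K) U"
    "\<And>A. A \<in> \<U> \<Longrightarrow> \<not> eventually (\<lambda>x. x \<in> A) U"
proof -
  define F where "F = inf (principal K) (INF A\<in>\<U>. principal (- A))"
  have ev: "eventually P (INF A\<in>\<U>. principal (- A)) \<longleftrightarrow> (\<exists>\<F>\<subseteq>\<U>. finite \<F> \<and> eventually P (INF A\<in>\<F>. principal (- A)))" for P
    by (subst eventually_INF) auto
  have "F \<noteq> bot"
  proof
    assume "F = bot"
    then have "eventually (\<lambda>_. False) F" by simp
    then have "eventually (\<lambda>x. x \<notin> K) (INF A\<in>\<U>. principal (- A))"
      by (simp add: F_def inf_commute[of "principal K"] eventually_inf_principal)
    then obtain \<F> where \<F>: "\<F> \<subseteq> \<U>" "finite \<F>" "eventually (\<lambda>x. x \<notin> K) (INF A\<in>\<F>. principal (- A))"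
      unfolding ev by blast
    have "(INF A\<in>\<F>. principal (- A)) = principal (\<Inter>A\<in>\<F>. - A)"
      using INF_principal_finite[OF \<F>(2), of uminus] by simp
    then have "K \<subseteq> \<Union>\<F>" using \<F>(3) by (auto simp: eventually_principal)
    then show False using assms \<F> by blast
  qed
  then obtain U where U: "ultrafilter U" "U \<le> F" by (rule ex_ultrafilter_le)
  have "U \<le> principal K" using U(2) unfolding F_def by (rule order_trans) simp
  then have "eventually (\<lambda>x. x \<in> K) U" by (simp add: le_principal)
  moreover have "\<not> eventually (\<lambda>x. x \<in> A) U" if "A \<in> \<U>" for A
  proof
    assume "eventually (\<lambda>x. x \<in> A) U"
    moreover have "F \<le> principal (- A)"
      unfolding F_def using that by (intro le_infI2 INF_lower)
    then have "U \<le> principal (- A)" using U(2) order_trans by blast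
    then have "eventually (\<lambda>x. x \<notin> A) U" by (simp add: le_principal)
    ultimately have "eventually (\<lambda>_. False) U" by eventually_elim blast
    then show False using U(1) by (simp add: ultrafilter_def trivial_limit_def)
  qed
  ultimately show ?thesis using that U(1) by blast
qed

text \<open>Without a finite subcover some ultrafilter would avoid every member of the cover, in
  particular one that contains its limit.\<close>

lemma compactin_ultrafilterI:
  assumes "C \<subseteq> topspace X"
    and conv: "\<And>U. ultrafilter U \<Longrightarrow> eventually (\<lambda>x. x \<in> C) U \<Longrightarrow>
      \<exists>x\<in>C. \<forall>V. openin X V \<longrightarrow> x \<in> V \<longrightarrow> eventually (\<lambda>y. y \<in> V) U"
  shows "compactin X C"
  unfolding compactin_def
proof (intro conjI allI impI)
  fix \<U> assume \<U>: "Ball \<U> (openin X) \<and> C \<subseteq> \<Union>\<U>"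
  show "\<exists>\<F>. finite \<F> \<and> \<F> \<subseteq> \<U> \<and> C \<subseteq> \<Union>\<F>"
  proof (rule ccontr)
    assume "\<not> ?thesis"
    then have "\<And>\<F>. finite \<F> \<Longrightarrow> \<F> \<subseteq> \<U> \<Longrightarrow> \<not> C \<subseteq> \<Union>\<F>" by blast
    then obtain U where U: "ultrafilter U" "eventually (\<lambda>x. x \<in> C) U"
      "\<And>A. A \<in> \<U> \<Longrightarrow> \<not> eventually (\<lambda>x. x \<in> A) U"
      using ultrafilter_disjoint_finite_covers by (metis (no_types))
    obtain x where "x \<in> C" "\<And>V. openin X V \<Longrightarrow> x \<in> V \<Longrightarrow> eventually (\<lambda>y. y \<in> V) U"
      using conv[OF U(1,2)] by blast
    then show False using \<U> U(3) by blast
  qed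
qed (fact assms(1))

text \<open>If every point had a neighbourhood visited only finitely often, a finite subcover would
  leave only finitely many indices. For topologies that are not first countable, a cluster point is
  the sequential form of compactness at hand.\<close>

lemma compactin_sequence_cluster_point:
  assumes C: "compactin X C" and f: "\<And>n::nat. f n \<in> C"
  obtains x where "x \<in> C" "\<And>V. openin X V \<Longrightarrow> x \<in> V \<Longrightarrow> infinite {n. f n \<in> V}"
proof -
  have "\<exists>x\<in>C. \<forall>V. openin X V \<longrightarrow> x \<in> V \<longrightarrow> infinite {n. f n \<in> V}"
  proof (rule ccontr)
    assume "\<not> ?thesis"
    then have "\<forall>x\<in>C. \<exists>V. openin X V \<and> x \<in> V \<and> finite {n. f n \<in> V}" by blast
    then have "C \<subseteq> \<Union>{V. openin X V \<and> finite {n. f n \<in> V}}" by blast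
    then obtain \<F> where \<F>: "finite \<F>" "\<F> \<subseteq> {V. openin X V \<and> finite {n. f n \<in> V}}" "C \<subseteq> \<Union>\<F>"
      using compactinD[OF C, of "{V. openin X V \<and> finite {n. f n \<in> V}}"] by auto
    have "finite (\<Union>V\<in>\<F>. {n. f n \<in> V})" using \<F> by auto
    moreover have "(\<Union>V\<in>\<F>. {n. f n \<in> V}) = UNIV" using f \<F>(3) by blast
    ultimately show False by simp
  qed
  then show ?thesis using that by blast
qed

section \<open>Topologies induced by functionals, and relative compactness in regular spaces\<close>

lemma openin_induced_topology:
  "\<phi> \<in> \<Phi> \<Longrightarrow> open U \<Longrightarrow> openin (induced_topology S \<Phi>) {f \<in> S. \<phi> f \<in> U}"
  unfolding induced_topology_def by (rule topology_generated_by_Basis) blast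

lemma topspace_induced_topology:
  assumes "\<Phi> \<noteq> {}"
  shows "topspace (induced_topology S \<Phi>) = S"
proof -
  obtain \<phi> where "\<phi> \<in> \<Phi>" using assms by blast
  then have "S \<subseteq> topspace (induced_topology S \<Phi>)"
    using openin_subset[OF openin_induced_topology[of \<phi> \<Phi> UNIV S]] by simp
  then show ?thesis by (auto simp: induced_topology_def)
qed

lemma openin_induced_topology_coarsest:
  assumes "\<And>\<phi>. \<phi> \<in> \<Phi> \<Longrightarrow> continuous_map X euclideanreal \<phi>" "openin (induced_topology (topspace X) \<Phi>) U"
  shows "openin X U"
proof (rule generate_topology_on_coarsest)
  show "istopology (openin X)" by (rule istopology_openin)
  show "generate_topology_on {{f \<in> topspace X. \<phi> f \<in> U} | \<phi> U. \<phi> \<in> \<Phi> \<and> open U} U"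
    using assms(2) by (simp add: induced_topology_def openin_topology_generated_by_iff)
  show "openin X S" if "S \<in> {{f \<in> topspace X. \<phi> f \<in> U} | \<phi> U. \<phi> \<in> \<Phi> \<and> open U}" for S
    using that assms(1) unfolding continuous_map_def by auto
qed

text \<open>Closed neighbourhoods are found by induction on the generation of an open set. For a
  subbasic set they are preimages of closed balls in the reals; the other cases are finite
  intersections and unions.\<close>

lemma regular_space_induced_topology:
  assumes "\<Phi> \<noteq> {}"
  shows "regular_space (induced_topology S \<Phi>)"
proof -
  let ?X = "induced_topology S \<Phi>"
  have nbhd: "\<exists>V. openin ?X V \<and> x \<in> V \<and> ?X closure_of V \<subseteq> U"
    if "generate_topology_on {{f \<in> S. \<phi> f \<in> U} | \<phi> U. \<phi> \<in> \<Phi> \<and> open U} U" "x \<in> U" for U x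
    using that
  proof (induction arbitrary: x)
    case Empty
    then show ?case by simp
  next
    case (Int U1 U2)
    obtain V1 where V1: "openin ?X V1" "x \<in> V1" "?X closure_of V1 \<subseteq> U1"
      using Int.IH(1)[of x] Int.prems by auto
    obtain V2 where V2: "openin ?X V2" "x \<in> V2" "?X closure_of V2 \<subseteq> U2"
      using Int.IH(2)[of x] Int.prems by auto
    have "?X closure_of (V1 \<inter> V2) \<subseteq> U1 \<inter> U2"
      using closure_of_mono[of "V1 \<inter> V2" V1 ?X] closure_of_mono[of "V1 \<inter> V2" V2 ?X] V1(3) V2(3) by blast
    then show ?case using V1(1,2) V2(1,2) by (intro exI[of _ "V1 \<inter> V2"]) auto
  next
    case (UN \<U>)
    then obtain U where U: "U \<in> \<U>" "x \<in> U" by blast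
    then obtain V where "openin ?X V" "x \<in> V" "?X closure_of V \<subseteq> U" using UN.IH by blast
    then show ?case using U(1) by blast
  next
    case (Basis U)
    then obtain \<phi> W where W: "\<phi> \<in> \<Phi>" "open W" "U = {f \<in> S. \<phi> f \<in> W}" by blast
    have "\<phi> x \<in> W" using Basis.prems W(3) by simp
    then obtain e where e: "e > 0" "cball (\<phi> x) e \<subseteq> W" using W(2) open_contains_cball_eq by blast
    let ?V = "{f \<in> S. \<phi> f \<in> ball (\<phi> x) e}" and ?C = "{f \<in> S. \<phi> f \<in> cball (\<phi> x) e}"
    have "?C = topspace ?X - {f \<in> S. \<phi> f \<in> - cball (\<phi> x) e}"
      using topspace_induced_topology[OF assms, of S] by auto
    then have "closedin ?X ?C"
      using openin_induced_topology[OF W(1), of "- cball (\<phi> x) e" S] by (auto intro!: closedin_diff)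
    then have "?X closure_of ?V \<subseteq> ?C" by (intro closure_of_minimal) auto
    moreover have "?C \<subseteq> U" using e(2) W(3) by auto
    moreover have "openin ?X ?V" by (rule openin_induced_topology[OF W(1)]) simp
    ultimately show ?case using e(1) Basis.prems W(3) by (intro exI[of _ ?V]) auto
  qed
  show ?thesis
    unfolding regular_space
  proof (intro allI impI)
    fix C a assume C: "closedin ?X C \<and> a \<in> topspace ?X - C"
    then have "openin ?X (topspace ?X - C)" by blast
    then have "generate_topology_on {{f \<in> S. \<phi> f \<in> U} | \<phi> U. \<phi> \<in> \<Phi> \<and> open U} (topspace ?X - C)"
      by (simp add: induced_topology_def openin_topology_generated_by_iff)
    then obtain V where "openin ?X V" "a \<in> V" "?X closure_of V \<subseteq> topspace ?X - C"
      using nbhd C by blast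
    then show "\<exists>U. openin ?X U \<and> a \<in> U \<and> disjnt C (?X closure_of U)"
      by (intro exI[of _ V]) (auto simp: disjnt_def)
  qed
qed

text \<open>By regularity each point of \<open>A\<close> has a neighbourhood whose closure lies in a
  member of the cover. Finitely many of these neighbourhoods contain \<open>A\<close>, and the
  closure of a finite union is the union of the closures.\<close>

lemma regular_space_compactin_closure_of:
  assumes X: "regular_space X" and A: "compactin X A"
  shows "compactin X (X closure_of A)"
  unfolding compactin_def
proof (intro conjI allI impI)
  fix \<U> assume \<U>: "Ball \<U> (openin X) \<and> X closure_of A \<subseteq> \<Union>\<U>"
  let ?\<V> = "{V. openin X V \<and> (\<exists>U\<in>\<U>. X closure_of V \<subseteq> U)}"
  have "A \<subseteq> \<Union>?\<V>"
  proof
    fix x assume x: "x \<in> A"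
    then have "x \<in> X closure_of A" using closure_of_subset[OF compactin_subset_topspace[OF A]] by blast
    then obtain U where U: "U \<in> \<U>" "x \<in> U" using \<U> by blast
    then have "closedin X (topspace X - U)" "x \<in> topspace X - (topspace X - U)"
      using \<U> openin_subset by blast+
    then obtain V where V: "openin X V" "x \<in> V" "disjnt (topspace X - U) (X closure_of V)"
      using X unfolding regular_space by blast
    then have "X closure_of V \<subseteq> U" using closure_of_subset_topspace[of X V] by (auto simp: disjnt_def)
    then show "x \<in> \<Union>?\<V>" using V U by blast
  qed
  then obtain \<F> where \<F>: "finite \<F>" "\<F> \<subseteq> ?\<V>" "A \<subseteq> \<Union>\<F>"
    using compactinD[OF A, of ?\<V>] by auto
  then have "\<forall>V\<in>\<F>. \<exists>U. U \<in> \<U> \<and> X closure_of V \<subseteq> U" by blast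
  then obtain u where u: "\<forall>V\<in>\<F>. u V \<in> \<U> \<and> X closure_of V \<subseteq> u V" by (rule bchoice[THEN exE])
  have "X closure_of A \<subseteq> X closure_of \<Union>\<F>" by (rule closure_of_mono[OF \<F>(3)])
  also have "\<dots> = (\<Union>V\<in>\<F>. X closure_of V)" by (rule closure_of_Union[OF \<F>(1)])
  also have "\<dots> \<subseteq> \<Union>(u ` \<F>)" using u by blast
  finally show "\<exists>\<F>. finite \<F> \<and> \<F> \<subseteq> \<U> \<and> X closure_of A \<subseteq> \<Union>\<F>"
    using \<F>(1) u by (intro exI[of _ "u ` \<F>"]) auto
qed (rule closure_of_subset_topspace)

text \<open>The closure in \<open>X\<close> stays compact in \<open>Y\<close> but need not be closed
  there. Its closure in \<open>Y\<close> is compact by regularity and contains the closure of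
  \<open>K\<close> in \<open>Y\<close>.\<close>

lemma relatively_compactin_coarser:
  assumes K: "relatively_compactin X K" and Y: "regular_space Y" "topspace Y = topspace X"
    and coarser: "\<And>U. openin Y U \<Longrightarrow> openin X U"
  shows "relatively_compactin Y K"
proof -
  have sub: "K \<subseteq> topspace X" and C: "compactin X (X closure_of K)"
    using K by (auto simp: relatively_compactin_def)
  have "compactin Y (X closure_of K)"
    unfolding compactin_def
  proof (intro conjI allI impI)
    fix \<U> assume "Ball \<U> (openin Y) \<and> X closure_of K \<subseteq> \<Union>\<U>"
    then show "\<exists>\<F>. finite \<F> \<and> \<F> \<subseteq> \<U> \<and> X closure_of K \<subseteq> \<Union>\<F>"
      using compactinD[OF C, of \<U>] coarser by blast
  qed (simp add: Y(2) closure_of_subset_topspace)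
  then have "compactin Y (Y closure_of (X closure_of K))"
    by (rule regular_space_compactin_closure_of[OF Y(1)])
  then have "compactin Y (Y closure_of K)"
    by (rule closed_compactin) (auto intro!: closure_of_mono closure_of_subset sub)
  then show ?thesis using sub Y(2) by (simp add: relatively_compactin_def)
qed

section \<open>Gliding hump\<close>

text \<open>Subsequences are needed in the clustering hypothesis: the hump is first built around a cluster
  point \<open>z\<close> of \<open>y\<close>, and then a cluster point of the selected subsequence, which agrees with \<open>z\<close> on
  the selected coordinates, gives the contradiction.\<close>

lemma gliding_hump:
  fixes y :: "nat \<Rightarrow> nat \<Rightarrow> real"
  defines "S \<equiv> \<lambda>J z. \<Sum>i. indicator J i * z i"
  assumes y: "\<And>k. summable (\<lambda>i. \<bar>y k i\<bar>)" and \<epsilon>: "\<epsilon> > 0"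
    and cluster: "\<And>k :: nat \<Rightarrow> nat. \<exists>z. summable (\<lambda>i. \<bar>z i\<bar>) \<and> (\<forall>\<J> \<delta>. finite \<J> \<longrightarrow> \<delta> > 0 \<longrightarrow>
        infinite {j. \<forall>J\<in>\<J>. \<bar>S J (y (k j)) - S J z\<bar> < \<delta>})"
  shows "\<exists>k. y k k < \<epsilon>"
proof (rule ccontr)
  assume "\<not> ?thesis"
  then have big: "y k k \<ge> \<epsilon>" for k by (meson not_less)
  \<comment> \<open>Singletons let the cluster hypothesis control finitely many coordinates; an
    infinite \<open>J\<close> enters only at the end.\<close>
  have S_sing: "S {i} z = z i" for i z
  proof -
    have "S {i} z = (\<Sum>j\<in>{i}. indicator {i} j * z j)"
      unfolding S_def by (rule suminf_finite) auto
    then show ?thesis by simp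
  qed
  have summ: "summable (\<lambda>i. \<bar>indicator J i * z i\<bar>)" if "summable (\<lambda>i. \<bar>z i\<bar>)" for J and z :: "nat \<Rightarrow> real"
    by (rule summable_comparison_test'[OF that, of 0]) (auto split: split_indicator)
  have summ': "summable (\<lambda>i. indicator J i * z i)" if "summable (\<lambda>i. \<bar>z i\<bar>)" for J and z :: "nat \<Rightarrow> real"
    using summ[OF that, of J] by (rule summable_rabs_cancel)
  obtain z where z: "summable (\<lambda>i. \<bar>z i\<bar>)" and zc: "\<And>\<J> \<delta>. finite \<J> \<Longrightarrow> \<delta> > 0 \<Longrightarrow>
        infinite {j. \<forall>J\<in>\<J>. \<bar>S J (y j) - S J z\<bar> < \<delta>}"
    using cluster[of id] by auto
  define u where "u k i = y k i - z i" for k i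
  have u: "summable (\<lambda>i. \<bar>u k i\<bar>)" for k
    unfolding u_def
    by (rule summable_comparison_test'[OF summable_add[OF y[of k] z], of 0]) auto
  have S_diff: "S J (y k) - S J z = S J (u k)" for J k
    unfolding S_def u_def using suminf_diff[OF summ'[OF y[of k], of J] summ'[OF z, of J]]
    by (simp add: algebra_simps)
  have "z \<longlonglongrightarrow> 0" using summable_LIMSEQ_zero[OF z] by (simp add: tendsto_rabs_zero_iff)
  then have "eventually (\<lambda>n. \<bar>z n\<bar> < \<epsilon> / 8) sequentially"
    using \<epsilon> by (auto simp: tendsto_iff dist_real_def dest!: spec[of _ "\<epsilon> / 8"])
  then obtain N0 where N0: "\<And>n. n \<ge> N0 \<Longrightarrow> \<bar>z n\<bar> < \<epsilon> / 8" by (auto simp: eventually_sequentially)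
  let ?P = "\<lambda>n. \<bar>z n\<bar> < \<epsilon> / 8"
  \<comment> \<open>The \<open>m + 1\<close> head coordinates of the next difference contribute less
    than \<epsilon>/8 in all, and so does the part of the present difference from \<open>n\<close>
    on. Hence consecutive humps hardly interact.\<close>
  let ?Q = "\<lambda>m n. m < n \<and> (\<forall>i\<le>m. \<bar>u n i\<bar> < \<epsilon> / (8 * real (m + 1))) \<and> (\<Sum>i. \<bar>u m (i + n)\<bar>) < \<epsilon> / 8"
  have "\<exists>k. \<forall>j. ?P (k j) \<and> ?Q (k j) (k (Suc j))"
  proof (rule dependent_nat_choice)
    show "\<exists>n. ?P n" using N0 by blast
    fix m :: nat
    obtain N1 where N1: "\<And>n. n \<ge> N1 \<Longrightarrow> \<bar>\<Sum>i. \<bar>u m (i + n)\<bar>\<bar> < \<epsilon> / 8"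
      using suminf_exist_split[OF _ u[of m], of "\<epsilon> / 8"] \<epsilon> by auto
    have "infinite {j. \<forall>J\<in>(\<lambda>i. {i}) ` {..m}. \<bar>S J (y j) - S J z\<bar> < \<epsilon> / (8 * real (m + 1))}"
      using \<epsilon> by (intro zc) auto
    then obtain n where n: "n > max m (max N0 N1)"
      "\<forall>J\<in>(\<lambda>i. {i}) ` {..m}. \<bar>S J (y n) - S J z\<bar> < \<epsilon> / (8 * real (m + 1))"
      unfolding infinite_nat_iff_unbounded by blast
    have "\<forall>i\<le>m. \<bar>u n i\<bar> < \<epsilon> / (8 * real (m + 1))"
      using n(2) by (simp add: S_sing u_def)
    moreover have "(\<Sum>i. \<bar>u m (i + n)\<bar>) < \<epsilon> / 8" using N1[of n] n(1) by auto
    ultimately show "\<exists>n. ?P n \<and> ?Q m n" using n(1) N0[of n] by auto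
  qed
  then obtain k where k: "\<And>j. \<bar>z (k j)\<bar> < \<epsilon> / 8" "\<And>j. k j < k (Suc j)"
    "\<And>j i. i \<le> k j \<Longrightarrow> \<bar>u (k (Suc j)) i\<bar> < \<epsilon> / (8 * real (k j + 1))"
    "\<And>j. (\<Sum>i. \<bar>u (k j) (i + k (Suc j))\<bar>) < \<epsilon> / 8"
    by blast
  have sm: "strict_mono k" using k(2) by (simp add: strict_mono_Suc_iff)
  then have k_ge: "j \<le> k j" for j by (rule strict_mono_imp_increasing)
  define J where "J = range k"
  \<comment> \<open>On \<open>J\<close>, row \<open>k j\<close> therefore has only three blocks: the
    indices up to the previous member, the hump at \<open>k j\<close>, and the tail from
    \<open>k (Suc j)\<close> on.\<close>
  have gap: "i \<le> k j" if "i \<in> J" "i < k (Suc j)" for i j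
  proof -
    obtain l where l: "i = k l" using \<open>i \<in> J\<close> by (auto simp: J_def)
    then have "l < Suc j" using that(2) sm by (simp add: strict_mono_less)
    then show ?thesis using l sm by (simp add: strict_mono_less_eq)
  qed
  \<comment> \<open>The hump is at least 7\<epsilon>/8, because \<open>y\<close> is at least
    \<epsilon> and \<open>z\<close> less than \<epsilon>/8 there. Head and tail each take away at
    most \<epsilon>/8, so 5\<epsilon>/8 remains.\<close>
  have large: "S J (u (k j)) \<ge> \<epsilon> / 2" for j
  proof -
    let ?v = "\<lambda>i. indicator J i * u (k j) i"
    have v: "summable ?v" "summable (\<lambda>i. \<bar>?v i\<bar>)" by (rule summ'[OF u] summ[OF u])+
    have "S J (u (k j)) = (\<Sum>i. ?v (i + k (Suc j))) + (\<Sum>i<k (Suc j). ?v i)"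
      unfolding S_def by (rule suminf_split_initial_segment[OF v(1)])
    also have "(\<Sum>i<k (Suc j). ?v i) = (\<Sum>i<Suc (k j). ?v i)"
      using k(2)[of j] by (intro sum.mono_neutral_right) (auto simp: indicator_def dest: gap[of _ j])
    also have "\<dots> = (\<Sum>i<k j. ?v i) + u (k j) (k j)" by (simp add: J_def)
    finally have eq: "S J (u (k j)) = (\<Sum>i. ?v (i + k (Suc j))) + (\<Sum>i<k j. ?v i) + u (k j) (k j)"
      by simp
    have "\<bar>\<Sum>i. ?v (i + k (Suc j))\<bar> \<le> (\<Sum>i. \<bar>?v (i + k (Suc j))\<bar>)"
      using v(2) by (intro summable_rabs) (subst summable_iff_shift[of "\<lambda>i. \<bar>?v i\<bar>"])
    also have "\<dots> \<le> (\<Sum>i. \<bar>u (k j) (i + k (Suc j))\<bar>)"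
      using v(2) u[of "k j"] summable_iff_shift[of "\<lambda>i. \<bar>?v i\<bar>"] summable_iff_shift[of "\<lambda>i. \<bar>u (k j) i\<bar>"]
      by (intro suminf_le) (auto split: split_indicator)
    finally have tail: "\<bar>\<Sum>i. ?v (i + k (Suc j))\<bar> < \<epsilon> / 8" using k(4)[of j] by simp
    have head: "\<bar>\<Sum>i<k j. ?v i\<bar> \<le> \<epsilon> / 8"
    proof (cases j)
      case 0
      have "i \<notin> J" if "i < k j" for i
        using that 0 sm by (auto simp: J_def strict_mono_less)
      then have "(\<Sum>i<k j. ?v i) = 0" by (intro sum.neutral) auto
      then show ?thesis using \<epsilon> by simp
    next
      case (Suc l)
      have "(\<Sum>i<k j. ?v i) = (\<Sum>i<Suc (k l). ?v i)"
        using k(2)[of l] Suc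
        by (intro sum.mono_neutral_right) (auto simp: indicator_def dest: gap[of _ l])
      also have "\<bar>\<dots>\<bar> \<le> (\<Sum>i<Suc (k l). \<epsilon> / (8 * real (k l + 1)))"
      proof (rule order_trans[OF sum_abs sum_mono])
        fix i assume "i \<in> {..<Suc (k l)}"
        then have "\<bar>u (k j) i\<bar> < \<epsilon> / (8 * real (k l + 1))" using k(3)[of i l] Suc by simp
        then show "\<bar>?v i\<bar> \<le> \<epsilon> / (8 * real (k l + 1))"
          using \<epsilon> by (auto split: split_indicator)
      qed
      also have "\<dots> = \<epsilon> / 8" by (simp add: field_simps)
      finally show ?thesis .
    qed
    have "u (k j) (k j) \<ge> \<epsilon> - \<epsilon> / 8" using big[of "k j"] k(1)[of j] by (simp add: u_def abs_less_iff)
    then show ?thesis using eq tail head \<epsilon> by linarith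
  qed
  obtain z' where z': "summable (\<lambda>i. \<bar>z' i\<bar>)" and z'c: "\<And>\<J> \<delta>. finite \<J> \<Longrightarrow> \<delta> > 0 \<Longrightarrow>
        infinite {j. \<forall>J\<in>\<J>. \<bar>S J (y (k j)) - S J z'\<bar> < \<delta>}"
    using cluster[of k] by auto
  \<comment> \<open>The head condition makes \<open>u (k j) i\<close> vanish as \<open>j\<close>
    grows, so the selected rows converge to \<open>z\<close> at each coordinate in \<open>J\<close>;
    a cluster point of these rows has no choice there.\<close>
  have "z' i = z i" if "i \<in> J" for i
  proof -
    obtain l where l: "i = k l" using \<open>i \<in> J\<close> by (auto simp: J_def)
    have "\<bar>z' i - z i\<bar> \<le> \<eta>" if \<eta>: "\<eta> > 0" for \<eta>
    proof -
      obtain N :: nat where N: "\<epsilon> / \<eta> < real N" using reals_Archimedean2 by blast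
      have "infinite {j. \<forall>J\<in>{{i}}. \<bar>S J (y (k j)) - S J z'\<bar> < \<eta> / 2}" using \<eta> by (intro z'c) auto
      then obtain j where j: "j > max (Suc l) (Suc N)" "\<bar>y (k j) i - z' i\<bar> < \<eta> / 2"
        unfolding infinite_nat_iff_unbounded by (auto simp: S_sing)
      obtain j' where j': "j = Suc j'" using j(1) by (cases j) auto
      have "i \<le> k j'" using l j j' sm by (auto simp: strict_mono_less_eq)
      then have "\<bar>u (k j) i\<bar> < \<epsilon> / (8 * real (k j' + 1))" using k(3)[of i j'] j' by simp
      also have "\<dots> \<le> \<epsilon> / (2 * real N)"
      proof (rule divide_left_mono)
        have "N \<le> k j'" using k_ge[of j'] j j' by simp
        then have "real N \<le> real (k j')" by simp
        then show "2 * real N \<le> 8 * real (k j' + 1)" by simp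
        have "real N > 0" using N \<epsilon> \<eta> by (smt (verit) divide_pos_pos)
        then show "0 < 8 * real (k j' + 1) * (2 * real N)" by simp
      qed (use \<epsilon> in simp)
      also have "\<dots> \<le> \<eta> / 2"
      proof -
        have "real N > 0" using N \<epsilon> \<eta> by (smt (verit) divide_pos_pos)
        then show ?thesis using N \<eta> by (simp add: field_simps)
      qed
      finally show ?thesis using j(2) unfolding u_def by linarith
    qed
    then have "\<bar>z' i - z i\<bar> \<le> 0" by (rule field_le_epsilon[of _ 0, simplified])
    then show ?thesis by simp
  qed
  \<comment> \<open>\<open>z\<close> and \<open>z'\<close> may differ off \<open>J\<close>, but
    \<open>S J\<close> does not see this. Being near \<open>S J z'\<close> now means that the sum
    over \<open>J\<close> of some difference is below \<epsilon>/8, against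
    \<open>large\<close>.\<close>
  then have eq: "S J z' = S J z" unfolding S_def by (intro suminf_cong) (auto split: split_indicator)
  have "infinite {j. \<forall>J\<in>{J}. \<bar>S J (y (k j)) - S J z'\<bar> < \<epsilon> / 8}" using \<epsilon> by (intro z'c) auto
  then obtain j where "\<bar>S J (y (k j)) - S J z'\<bar> < \<epsilon> / 8" by (auto dest!: not_finite_existsD)
  then show False using large[of j] S_diff[of J "k j"] eq \<epsilon> by simp
qed

section \<open>Bochner integrable functions\<close>

lemma strongly_measurable_simple_function:
  "simple_function M s \<Longrightarrow> strongly_measurable M s"
  unfolding strongly_measurable_def by (intro exI[of _ "\<lambda>_. s"]) auto

lemma strongly_measurable_compose2:
  assumes f: "strongly_measurable M f" and g: "strongly_measurable M g"
    and h: "continuous_on UNIV (\<lambda>p. h (fst p) (snd p))"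
  shows "strongly_measurable M (\<lambda>x. h (f x) (g x))"
proof -
  obtain s where s: "\<And>n. simple_function M (s n)" "\<And>x. x \<in> space M \<Longrightarrow> (\<lambda>n. s n x) \<longlonglongrightarrow> f x"
    using f unfolding strongly_measurable_def by blast
  obtain t where t: "\<And>n. simple_function M (t n)" "\<And>x. x \<in> space M \<Longrightarrow> (\<lambda>n. t n x) \<longlonglongrightarrow> g x"
    using g unfolding strongly_measurable_def by blast
  have "(\<lambda>n. h (s n x) (t n x)) \<longlonglongrightarrow> h (f x) (g x)" if "x \<in> space M" for x
    using continuous_on_tendsto_compose[OF h tendsto_Pair[OF s(2)[OF that] t(2)[OF that]]] by simp
  then show ?thesis
    unfolding strongly_measurable_def
    using simple_function_compose2[OF s(1) t(1), of h] by (intro exI[of _ "\<lambda>n x. h (s n x) (t n x)"]) auto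
qed

lemma strongly_measurable_intros:
  fixes f g :: "'a \<Rightarrow> 'b::real_normed_vector"
  shows strongly_measurable_add: "strongly_measurable M f \<Longrightarrow> strongly_measurable M g \<Longrightarrow> strongly_measurable M (\<lambda>x. f x + g x)"
    and strongly_measurable_diff: "strongly_measurable M f \<Longrightarrow> strongly_measurable M g \<Longrightarrow> strongly_measurable M (\<lambda>x. f x - g x)"
    and strongly_measurable_scaleR: "strongly_measurable M r \<Longrightarrow> strongly_measurable M g \<Longrightarrow> strongly_measurable M (\<lambda>x. r x *\<^sub>R g x)"
    and strongly_measurable_const: "strongly_measurable M (\<lambda>x. c :: 'b)"
    and borel_measurable_strongly_norm: "strongly_measurable M f \<Longrightarrow> (\<lambda>x. norm (f x)) \<in> borel_measurable M"
proof -
  show "strongly_measurable M f \<Longrightarrow> strongly_measurable M g \<Longrightarrow> strongly_measurable M (\<lambda>x. f x + g x)"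
    by (rule strongly_measurable_compose2) (auto intro!: continuous_intros)
  show "strongly_measurable M f \<Longrightarrow> strongly_measurable M g \<Longrightarrow> strongly_measurable M (\<lambda>x. f x - g x)"
    by (rule strongly_measurable_compose2) (auto intro!: continuous_intros)
  show "strongly_measurable M r \<Longrightarrow> strongly_measurable M g \<Longrightarrow> strongly_measurable M (\<lambda>x. r x *\<^sub>R g x)"
    by (rule strongly_measurable_compose2) (auto intro!: continuous_intros)
  show "strongly_measurable M (\<lambda>x. c :: 'b)"
    by (rule strongly_measurable_simple_function) simp
  show "strongly_measurable M f \<Longrightarrow> (\<lambda>x. norm (f x)) \<in> borel_measurable M"
    unfolding strongly_measurable_iff_borel[symmetric]
    by (rule strongly_measurable_compose2[where h = "\<lambda>x y. norm x"]) (auto intro!: continuous_intros)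
qed

lemma borel_measurable_strongly_pairing:
  fixes b :: "'a \<Rightarrow> 'b::real_normed_vector \<Rightarrow>\<^sub>L real"
  assumes "strongly_measurable M b" "strongly_measurable M f"
  shows "(\<lambda>x. blinfun_apply (b x) (f x)) \<in> borel_measurable M"
  unfolding strongly_measurable_iff_borel[symmetric]
  by (rule strongly_measurable_compose2[OF assms]) (auto intro!: continuous_intros)

lemma strongly_measurable_indicator:
  "A \<in> sets M \<Longrightarrow> strongly_measurable M (indicator A :: _ \<Rightarrow> real)"
  by (simp add: strongly_measurable_iff_borel)

context finite_measure
begin

lemma simple_function_imp_bochner_integrable:
  "simple_function M s \<Longrightarrow> Bochner_Integration.simple_bochner_integrable M s"
  by (rule simple_bochner_integrable.intros) auto

lemma integrable_norm_simple_function: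
  "simple_function M (s :: 'a \<Rightarrow> 'b::real_normed_vector) \<Longrightarrow> integrable M (\<lambda>x. norm (s x))"
  by (intro integrableI_simple_bochner_integrable simple_function_imp_bochner_integrable
      simple_function_compose1[where g = norm])

lemma norm_simple_bochner_integral_le:
  fixes s :: "'a \<Rightarrow> 'b::real_normed_vector"
  assumes "simple_function M s"
  shows "norm (Bochner_Integration.simple_bochner_integral M s) \<le> (LINT x|M. norm (s x))"
  using simple_bochner_integral_norm_bound[OF simple_function_imp_bochner_integrable[OF assms]]
    simple_bochner_integrable_eq_integral[OF simple_function_imp_bochner_integrable,
      OF simple_function_compose1[OF assms, of norm]] by simp

lemma L1_spaceD:
  fixes f :: "'a \<Rightarrow> 'e::banach"
  assumes "f \<in> L1_space M"
  shows strongly_measurable_L1: "strongly_measurable M f"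
    and integrable_norm_L1: "integrable M (\<lambda>x. norm (f x))"
    and L1_simple_approx: "\<epsilon> > 0 \<Longrightarrow> \<exists>s. simple_function M s \<and> L1_norm M (\<lambda>x. f x - s x) < \<epsilon>"
proof -
  obtain I where I: "has_Bochner_integral M f I"
    using assms by (auto simp: L1_space_def Bochner_integrable_def)
  show sm: "strongly_measurable M f" using I by (simp add: has_Bochner_integral_def)
  obtain s where s: "\<And>n. Bochner_Integration.simple_bochner_integrable M (s n)"
    "(\<lambda>n. \<integral>\<^sup>+x. ennreal (norm (f x - s n x)) \<partial>M) \<longlonglongrightarrow> 0"
    using I unfolding has_Bochner_integral_def by blast
  have simple: "simple_function M (s n)" for n
    using s(1)[of n] by (auto elim: simple_bochner_integrable.cases)
  have approx: "\<exists>n. (\<integral>\<^sup>+x. ennreal (norm (f x - s n x)) \<partial>M) < ennreal \<epsilon>" if "\<epsilon> > 0" for \<epsilon>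
  proof -
    have "eventually (\<lambda>n. (\<integral>\<^sup>+x. ennreal (norm (f x - s n x)) \<partial>M) < ennreal \<epsilon>) sequentially"
      using that by (intro order_tendstoD(2)[OF s(2)]) simp
    then show ?thesis by (meson eventually_happens trivial_limit_sequentially)
  qed
  have meas: "(\<lambda>x. norm (f x - s n x)) \<in> borel_measurable M" for n
    by (intro borel_measurable_strongly_norm strongly_measurable_diff sm
        strongly_measurable_simple_function simple)
  have int: "integrable M (\<lambda>x. norm (f x - s n x))"
    if "(\<integral>\<^sup>+x. ennreal (norm (f x - s n x)) \<partial>M) < ennreal \<epsilon>" for n \<epsilon>
    by (rule integrableI_bounded) (use meas that in \<open>auto intro: less_trans\<close>)
  \<comment> \<open>The approximation errors may be infinite for early indices, so an index with
    finite error is taken to transfer integrability from \<open>s n\<close> to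
    \<open>f\<close>.\<close>
  obtain n where n: "integrable M (\<lambda>x. norm (f x - s n x))" using approx[of 1] int by (metis zero_less_one)
  show "integrable M (\<lambda>x. norm (f x))"
  proof (rule Bochner_Integration.integrable_bound)
    show "integrable M (\<lambda>x. norm (f x - s n x) + norm (s n x))"
      by (intro Bochner_Integration.integrable_add n integrable_norm_simple_function simple)
    show "AE x in M. norm (norm (f x)) \<le> norm (norm (f x - s n x) + norm (s n x))"
      using norm_triangle_sub by (intro AE_I2) (simp add: add.commute)
  qed (rule borel_measurable_strongly_norm[OF sm])
  assume "\<epsilon> > 0"
  then obtain n where n: "(\<integral>\<^sup>+x. ennreal (norm (f x - s n x)) \<partial>M) < ennreal \<epsilon>" using approx by blast
  then have "ennreal (L1_norm M (\<lambda>x. f x - s n x)) < ennreal \<epsilon>"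
    unfolding L1_norm_def using nn_integral_eq_integral[OF int[OF n]] by simp
  then have "L1_norm M (\<lambda>x. f x - s n x) < \<epsilon>"
    unfolding L1_norm_def by (subst (asm) ennreal_less_iff) auto
  then show "\<exists>s. simple_function M s \<and> L1_norm M (\<lambda>x. f x - s x) < \<epsilon>" using simple by blast
qed

text \<open>The integrals of \<open>s n\<close> differ by at most the two approximation errors, so
  they form a Cauchy sequence, and completeness of the value space supplies the integral. Together
  with \<open>L1_simple_sequence\<close> this reduces the rules for the integral to simple
  functions.\<close>

lemma L1_limit_simple_functions:
  fixes f :: "'a \<Rightarrow> 'e::banach"
  assumes f: "strongly_measurable M f" and s: "\<And>n. simple_function M (s n)"
    and int: "\<And>n. integrable M (\<lambda>x. norm (f x - s n x))"
    and lim: "(\<lambda>n. L1_norm M (\<lambda>x. f x - s n x)) \<longlonglongrightarrow> 0"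
  shows "f \<in> L1_space M"
    and "(\<lambda>n. Bochner_Integration.simple_bochner_integral M (s n)) \<longlonglongrightarrow> Bochner_integral M f"
proof -
  let ?I = "Bochner_Integration.simple_bochner_integral M"
  have diff: "norm (?I (s m) - ?I (s n)) \<le> L1_norm M (\<lambda>x. f x - s m x) + L1_norm M (\<lambda>x. f x - s n x)" for m n
  proof -
    have "norm (?I (s m) - ?I (s n)) = norm (?I (\<lambda>x. s m x - s n x))"
      using simple_function_imp_bochner_integrable[OF s] by (simp add: simple_bochner_integral_diff)
    also have "\<dots> \<le> (LINT x|M. norm (s m x - s n x))"
      by (intro norm_simple_bochner_integral_le simple_function_compose2[OF s s])
    also have "\<dots> \<le> (LINT x|M. norm (f x - s m x) + norm (f x - s n x))"
    proof (rule integral_mono)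
      show "integrable M (\<lambda>x. norm (s m x - s n x))"
        by (intro integrable_norm_simple_function simple_function_compose2[OF s s])
      show "norm (s m x - s n x) \<le> norm (f x - s m x) + norm (f x - s n x)" for x
        using norm_triangle_ineq4[of "f x - s n x" "f x - s m x"] by (simp add: algebra_simps)
    qed (use int in auto)
    also have "\<dots> = L1_norm M (\<lambda>x. f x - s m x) + L1_norm M (\<lambda>x. f x - s n x)"
      unfolding L1_norm_def using int by simp
    finally show ?thesis .
  qed
  have "Cauchy (\<lambda>n. ?I (s n))"
  proof (rule CauchyI)
    fix e :: real assume e: "e > 0"
    have "eventually (\<lambda>n. L1_norm M (\<lambda>x. f x - s n x) < e / 2) sequentially"
      using e by (intro order_tendstoD(2)[OF lim]) simp
    then obtain N where "\<And>n. n \<ge> N \<Longrightarrow> L1_norm M (\<lambda>x. f x - s n x) < e / 2"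
      by (auto simp: eventually_sequentially)
    then have "\<forall>m\<ge>N. \<forall>n\<ge>N. norm (?I (s m) - ?I (s n)) < e"
      using diff by (smt (verit) field_sum_of_halves)
    then show "\<exists>N. \<forall>m\<ge>N. \<forall>n\<ge>N. norm (?I (s m) - ?I (s n)) < e" by blast
  qed
  then obtain I where I: "(\<lambda>n. ?I (s n)) \<longlonglongrightarrow> I" by (auto simp: Cauchy_convergent_iff convergent_def)
  have "(\<integral>\<^sup>+x. ennreal (norm (f x - s n x)) \<partial>M) = ennreal (L1_norm M (\<lambda>x. f x - s n x))" for n
    unfolding L1_norm_def by (rule nn_integral_eq_integral) (use int in auto)
  moreover have "(\<lambda>n. ennreal (L1_norm M (\<lambda>x. f x - s n x))) \<longlonglongrightarrow> 0"
    using tendsto_ennrealI[OF lim] by simp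
  ultimately have "has_Bochner_integral M f I"
    unfolding has_Bochner_integral_def
    using f I simple_function_imp_bochner_integrable[OF s] by (auto intro!: exI[of _ s])
  moreover from this have "Bochner_integral M f = I"
    unfolding Bochner_integral_def by (blast intro: has_Bochner_integral_unique)
  ultimately show "f \<in> L1_space M" "(\<lambda>n. ?I (s n)) \<longlonglongrightarrow> Bochner_integral M f"
    using I by (auto simp: L1_space_def Bochner_integrable_def)
qed

lemma L1_simple_sequence:
  fixes f :: "'a \<Rightarrow> 'e::banach"
  assumes "f \<in> L1_space M"
  obtains s where "\<And>n. simple_function M (s n)" "\<And>n. integrable M (\<lambda>x. norm (f x - s n x))"
    "(\<lambda>n. L1_norm M (\<lambda>x. f x - s n x)) \<longlonglongrightarrow> 0"
    "(\<lambda>n. Bochner_Integration.simple_bochner_integral M (s n)) \<longlonglongrightarrow> Bochner_integral M f"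
proof -
  have "\<exists>s. simple_function M s \<and> L1_norm M (\<lambda>x. f x - s x) < inverse (real (Suc n))" for n
    using L1_simple_approx[OF assms] by simp
  then obtain s where s: "\<And>n. simple_function M (s n)"
    "\<And>n. L1_norm M (\<lambda>x. f x - s n x) < inverse (real (Suc n))" by metis
  have int: "integrable M (\<lambda>x. norm (f x - s n x))" for n
  proof (rule Bochner_Integration.integrable_bound)
    show "integrable M (\<lambda>x. norm (f x) + norm (s n x))"
      by (intro Bochner_Integration.integrable_add integrable_norm_L1[OF assms] integrable_norm_simple_function s)
    show "AE x in M. norm (norm (f x - s n x)) \<le> norm (norm (f x) + norm (s n x))"
      using norm_triangle_ineq4 by (intro AE_I2) simp
  qed (intro borel_measurable_strongly_norm strongly_measurable_diff strongly_measurable_L1[OF assms]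
        strongly_measurable_simple_function s)
  have lim: "(\<lambda>n. L1_norm M (\<lambda>x. f x - s n x)) \<longlonglongrightarrow> 0"
  proof (rule tendsto_sandwich[OF _ _ tendsto_const LIMSEQ_inverse_real_of_nat])
    show "eventually (\<lambda>n. 0 \<le> L1_norm M (\<lambda>x. f x - s n x)) sequentially"
      by (auto simp: L1_norm_def)
    show "eventually (\<lambda>n. L1_norm M (\<lambda>x. f x - s n x) \<le> inverse (real (Suc n))) sequentially"
      using less_imp_le[OF s(2)] by (intro always_eventually) blast
  qed
  show ?thesis
    using that[OF s(1) int lim L1_limit_simple_functions(2)[OF strongly_measurable_L1[OF assms] s(1) int lim]] .
qed

lemma L1_simple_function:
  fixes s :: "'a \<Rightarrow> 'e::banach"
  assumes "simple_function M s"
  shows "s \<in> L1_space M" "Bochner_integral M s = Bochner_Integration.simple_bochner_integral M s"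
  using L1_limit_simple_functions[OF strongly_measurable_simple_function[OF assms], of "\<lambda>_. s"] assms
  by (auto simp: L1_norm_def LIMSEQ_const_iff)

section \<open>Linearity, restriction to sets and the norm bound of the Bochner integral\<close>

lemma L1_add:
  fixes f g :: "'a \<Rightarrow> 'e::banach"
  assumes f: "f \<in> L1_space M" and g: "g \<in> L1_space M"
  shows "(\<lambda>x. f x + g x) \<in> L1_space M"
    and "Bochner_integral M (\<lambda>x. f x + g x) = Bochner_integral M f + Bochner_integral M g"
proof -
  obtain s where s: "\<And>n. simple_function M (s n)" "\<And>n. integrable M (\<lambda>x. norm (f x - s n x))"
    "(\<lambda>n. L1_norm M (\<lambda>x. f x - s n x)) \<longlonglongrightarrow> 0"
    "(\<lambda>n. Bochner_Integration.simple_bochner_integral M (s n)) \<longlonglongrightarrow> Bochner_integral M f"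
    using L1_simple_sequence[OF f] by blast
  obtain t where t: "\<And>n. simple_function M (t n)" "\<And>n. integrable M (\<lambda>x. norm (g x - t n x))"
    "(\<lambda>n. L1_norm M (\<lambda>x. g x - t n x)) \<longlonglongrightarrow> 0"
    "(\<lambda>n. Bochner_Integration.simple_bochner_integral M (t n)) \<longlonglongrightarrow> Bochner_integral M g"
    using L1_simple_sequence[OF g] by blast
  have sm: "strongly_measurable M (\<lambda>x. f x + g x)"
    by (intro strongly_measurable_add strongly_measurable_L1 f g)
  have simple: "simple_function M (\<lambda>x. s n x + t n x)" for n
    by (rule simple_function_compose2[OF s(1) t(1)])
  have le: "norm (f x + g x - (s n x + t n x)) \<le> norm (f x - s n x) + norm (g x - t n x)" for n x
    using norm_triangle_ineq[of "f x - s n x" "g x - t n x"] by (simp add: algebra_simps)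
  have int: "integrable M (\<lambda>x. norm (f x + g x - (s n x + t n x)))" for n
  proof (rule Bochner_Integration.integrable_bound)
    show "integrable M (\<lambda>x. norm (f x - s n x) + norm (g x - t n x))" using s t by simp
    show "AE x in M. norm (norm (f x + g x - (s n x + t n x))) \<le> norm (norm (f x - s n x) + norm (g x - t n x))"
      using le by (intro AE_I2) simp
  qed (intro borel_measurable_strongly_norm strongly_measurable_diff sm strongly_measurable_simple_function simple)
  have lim: "(\<lambda>n. L1_norm M (\<lambda>x. f x + g x - (s n x + t n x))) \<longlonglongrightarrow> 0"
  proof (rule tendsto_sandwich[OF _ _ tendsto_const])
    show "eventually (\<lambda>n. 0 \<le> L1_norm M (\<lambda>x. f x + g x - (s n x + t n x))) sequentially"
      by (auto simp: L1_norm_def)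
    show "(\<lambda>n. L1_norm M (\<lambda>x. f x - s n x) + L1_norm M (\<lambda>x. g x - t n x)) \<longlonglongrightarrow> 0"
      using tendsto_add[OF s(3) t(3)] by simp
    have "L1_norm M (\<lambda>x. f x + g x - (s n x + t n x)) \<le> (LINT x|M. norm (f x - s n x) + norm (g x - t n x))" for n
      unfolding L1_norm_def by (intro integral_mono int le) (use s t in simp)
    then show "eventually (\<lambda>n. L1_norm M (\<lambda>x. f x + g x - (s n x + t n x)) \<le>
        L1_norm M (\<lambda>x. f x - s n x) + L1_norm M (\<lambda>x. g x - t n x)) sequentially"
      using s(2) t(2) by (auto simp: L1_norm_def)
  qed
  note res = L1_limit_simple_functions[OF sm simple int lim]
  show "(\<lambda>x. f x + g x) \<in> L1_space M" by (rule res(1))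
  have "(\<lambda>n. Bochner_Integration.simple_bochner_integral M (\<lambda>x. s n x + t n x)) \<longlonglongrightarrow> Bochner_integral M f + Bochner_integral M g"
    using tendsto_add[OF s(4) t(4)] simple_function_imp_bochner_integrable[OF s(1)]
      simple_function_imp_bochner_integrable[OF t(1)] by (simp add: simple_bochner_integral_add)
  then show "Bochner_integral M (\<lambda>x. f x + g x) = Bochner_integral M f + Bochner_integral M g"
    using res(2) LIMSEQ_unique by blast
qed

lemma L1_scaleR:
  fixes f :: "'a \<Rightarrow> 'e::banach"
  assumes f: "f \<in> L1_space M"
  shows "(\<lambda>x. c *\<^sub>R f x) \<in> L1_space M"
    and "Bochner_integral M (\<lambda>x. c *\<^sub>R f x) = c *\<^sub>R Bochner_integral M f"
proof -
  obtain s where s: "\<And>n. simple_function M (s n)" "\<And>n. integrable M (\<lambda>x. norm (f x - s n x))"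
    "(\<lambda>n. L1_norm M (\<lambda>x. f x - s n x)) \<longlonglongrightarrow> 0"
    "(\<lambda>n. Bochner_Integration.simple_bochner_integral M (s n)) \<longlonglongrightarrow> Bochner_integral M f"
    using L1_simple_sequence[OF f] by blast
  have eq: "norm (c *\<^sub>R f x - c *\<^sub>R s n x) = \<bar>c\<bar> * norm (f x - s n x)" for n x
    by (metis norm_scaleR scaleR_right_diff_distrib)
  have "strongly_measurable M (\<lambda>x. c *\<^sub>R f x)"
    by (intro strongly_measurable_scaleR strongly_measurable_L1 f strongly_measurable_const)
  moreover have "simple_function M (\<lambda>x. c *\<^sub>R s n x)" for n
    by (rule simple_function_compose1[OF s(1)])
  moreover have "integrable M (\<lambda>x. norm (c *\<^sub>R f x - c *\<^sub>R s n x))" for n using s(2) by (simp add: eq)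
  moreover have "(\<lambda>n. L1_norm M (\<lambda>x. c *\<^sub>R f x - c *\<^sub>R s n x)) \<longlonglongrightarrow> 0"
    using tendsto_mult_right_zero[OF s(3), of "\<bar>c\<bar>"] by (simp add: L1_norm_def eq)
  ultimately have res: "(\<lambda>x. c *\<^sub>R f x) \<in> L1_space M"
    "(\<lambda>n. Bochner_Integration.simple_bochner_integral M (\<lambda>x. c *\<^sub>R s n x)) \<longlonglongrightarrow> Bochner_integral M (\<lambda>x. c *\<^sub>R f x)"
    using L1_limit_simple_functions[of "\<lambda>x. c *\<^sub>R f x" "\<lambda>n x. c *\<^sub>R s n x"] by blast+
  show "(\<lambda>x. c *\<^sub>R f x) \<in> L1_space M" by (rule res(1))
  have "(\<lambda>n. Bochner_Integration.simple_bochner_integral M (\<lambda>x. c *\<^sub>R s n x)) \<longlonglongrightarrow> c *\<^sub>R Bochner_integral M f"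
    using tendsto_scaleR[OF tendsto_const s(4), of c]
      simple_bochner_integral_linear[OF bounded_linear.linear[OF bounded_linear_scaleR_right[of c]]
        simple_function_imp_bochner_integrable[OF s(1)]] by simp
  then show "Bochner_integral M (\<lambda>x. c *\<^sub>R f x) = c *\<^sub>R Bochner_integral M f"
    using res(2) LIMSEQ_unique by blast
qed

lemma L1_indicator:
  fixes f :: "'a \<Rightarrow> 'e::banach"
  assumes f: "f \<in> L1_space M" and A: "A \<in> sets M"
  shows "(\<lambda>x. indicator A x *\<^sub>R f x) \<in> L1_space M"
proof -
  obtain s where s: "\<And>n. simple_function M (s n)" "\<And>n. integrable M (\<lambda>x. norm (f x - s n x))"
    "(\<lambda>n. L1_norm M (\<lambda>x. f x - s n x)) \<longlonglongrightarrow> 0"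
    using L1_simple_sequence[OF f] by metis
  have eq: "norm (indicator A x *\<^sub>R f x - indicator A x *\<^sub>R s n x) = indicator A x *\<^sub>R norm (f x - s n x)" for n x
    by (auto split: split_indicator)
  have int: "integrable M (\<lambda>x. norm (indicator A x *\<^sub>R f x - indicator A x *\<^sub>R s n x))" for n
    unfolding eq using s(2) A by (intro integrable_mult_indicator)
  show ?thesis
  proof (rule L1_limit_simple_functions(1))
    show "strongly_measurable M (\<lambda>x. indicator A x *\<^sub>R f x)"
      by (intro strongly_measurable_scaleR strongly_measurable_L1 f strongly_measurable_indicator A)
    show "simple_function M (\<lambda>x. indicator A x *\<^sub>R s n x)" for n
      using simple_function_compose2[OF simple_function_indicator[OF A] s(1), of "\<lambda>a b. a *\<^sub>R b"] .
    show "(\<lambda>n. L1_norm M (\<lambda>x. indicator A x *\<^sub>R f x - indicator A x *\<^sub>R s n x)) \<longlonglongrightarrow> 0"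
    proof (rule tendsto_sandwich[OF _ _ tendsto_const s(3)])
      show "eventually (\<lambda>n. 0 \<le> L1_norm M (\<lambda>x. indicator A x *\<^sub>R f x - indicator A x *\<^sub>R s n x)) sequentially"
        by (auto simp: L1_norm_def)
      have "L1_norm M (\<lambda>x. indicator A x *\<^sub>R f x - indicator A x *\<^sub>R s n x) \<le> L1_norm M (\<lambda>x. f x - s n x)" for n
        unfolding L1_norm_def by (intro integral_mono int s) (auto split: split_indicator)
      then show "eventually (\<lambda>n. L1_norm M (\<lambda>x. indicator A x *\<^sub>R f x - indicator A x *\<^sub>R s n x) \<le> L1_norm M (\<lambda>x. f x - s n x)) sequentially"
        by simp
    qed
  qed (rule int)
qed

lemma L1_diff:
  fixes f g :: "'a \<Rightarrow> 'e::banach"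
  assumes f: "f \<in> L1_space M" and g: "g \<in> L1_space M"
  shows "(\<lambda>x. f x - g x) \<in> L1_space M"
    and "Bochner_integral M (\<lambda>x. f x - g x) = Bochner_integral M f - Bochner_integral M g"
  using L1_add[OF f L1_scaleR(1)[OF g, of "- 1"]] L1_scaleR(2)[OF g, of "- 1"] by simp_all

lemma norm_Bochner_integral_le:
  fixes f :: "'a \<Rightarrow> 'e::banach"
  assumes f: "f \<in> L1_space M"
  shows "norm (Bochner_integral M f) \<le> L1_norm M f"
proof -
  obtain s where s: "\<And>n. simple_function M (s n)" "\<And>n. integrable M (\<lambda>x. norm (f x - s n x))"
    "(\<lambda>n. L1_norm M (\<lambda>x. f x - s n x)) \<longlonglongrightarrow> 0"
    "(\<lambda>n. Bochner_Integration.simple_bochner_integral M (s n)) \<longlonglongrightarrow> Bochner_integral M f"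
    using L1_simple_sequence[OF f] by blast
  have "norm (Bochner_Integration.simple_bochner_integral M (s n)) \<le> L1_norm M (\<lambda>x. f x - s n x) + L1_norm M f" for n
  proof -
    have "norm (Bochner_Integration.simple_bochner_integral M (s n)) \<le> (LINT x|M. norm (s n x))"
      by (rule norm_simple_bochner_integral_le[OF s(1)])
    also have "\<dots> \<le> (LINT x|M. norm (f x - s n x) + norm (f x))"
    proof (rule integral_mono)
      show "norm (s n x) \<le> norm (f x - s n x) + norm (f x)" for x
        by (metis norm_minus_commute norm_triangle_sub add.commute)
    qed (use s integrable_norm_L1[OF f] integrable_norm_simple_function in auto)
    also have "\<dots> = L1_norm M (\<lambda>x. f x - s n x) + L1_norm M f"
      unfolding L1_norm_def using s integrable_norm_L1[OF f] by simp
    finally show ?thesis .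
  qed
  moreover have "(\<lambda>n. L1_norm M (\<lambda>x. f x - s n x) + L1_norm M f) \<longlonglongrightarrow> 0 + L1_norm M f"
    by (intro tendsto_intros s)
  ultimately show ?thesis
    using LIMSEQ_le[OF tendsto_norm[OF s(4)]] by fastforce
qed

lemma Bochner_integral_indicator_const:
  fixes v :: "'e::banach"
  assumes A: "A \<in> sets M"
  shows "Bochner_integral M (\<lambda>x. indicator A x *\<^sub>R v) = measure M A *\<^sub>R v"
proof -
  have lin: "linear (\<lambda>r :: real. r *\<^sub>R v)" by (rule bounded_linear.linear[OF bounded_linear_scaleR_left])
  have sb: "Bochner_Integration.simple_bochner_integrable M (indicator A :: 'a \<Rightarrow> real)"
    using A by (intro simple_function_imp_bochner_integrable) auto
  have "simple_function M (\<lambda>x. indicator A x *\<^sub>R v)"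
    using A by (intro simple_function_compose1[where g = "\<lambda>r. r *\<^sub>R v"]) auto
  then have "Bochner_integral M (\<lambda>x. indicator A x *\<^sub>R v) =
      Bochner_Integration.simple_bochner_integral M (\<lambda>x. indicator A x *\<^sub>R v)"
    by (rule L1_simple_function(2))
  also have "\<dots> = Bochner_Integration.simple_bochner_integral M (indicator A :: 'a \<Rightarrow> real) *\<^sub>R v"
    by (rule simple_bochner_integral_linear[OF lin sb])
  also have "Bochner_Integration.simple_bochner_integral M (indicator A :: 'a \<Rightarrow> real) = measure M A"
    using simple_bochner_integrable_eq_integral[OF sb] A sets.sets_into_space[OF A]
    by (simp add: Int_absorb2)
  finally show ?thesis .
qed

section \<open>Oscillation\<close>

lemma integrable_norm_L1_diff:
  fixes f g :: "'a \<Rightarrow> 'e::banach"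
  shows "f \<in> L1_space M \<Longrightarrow> g \<in> L1_space M \<Longrightarrow> integrable M (\<lambda>x. norm (f x - g x))"
  by (intro integrable_norm_L1 L1_diff)

lemma set_integrable_norm_L1_diff:
  fixes f g :: "'a \<Rightarrow> 'e::banach"
  assumes "f \<in> L1_space M" "g \<in> L1_space M" "A \<in> sets M"
  shows "set_integrable M A (\<lambda>x. norm (f x - g x))"
  unfolding set_integrable_def using assms by (intro integrable_mult_indicator integrable_norm_L1_diff)

lemma L1_const: "(\<lambda>x. v :: 'e::banach) \<in> L1_space M"
  by (rule L1_simple_function) simp

lemma L1_norm_commute: "L1_norm M (\<lambda>x. f x - g x) = L1_norm M (\<lambda>x. g x - f x)"
  by (simp add: L1_norm_def norm_minus_commute)

lemma L1_norm_triangle: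
  fixes f g h :: "'a \<Rightarrow> 'e::banach"
  assumes "f \<in> L1_space M" "g \<in> L1_space M" "h \<in> L1_space M"
  shows "L1_norm M (\<lambda>x. f x - h x) \<le> L1_norm M (\<lambda>x. f x - g x) + L1_norm M (\<lambda>x. g x - h x)"
proof -
  have "L1_norm M (\<lambda>x. f x - h x) \<le> (LINT x|M. norm (f x - g x) + norm (g x - h x))"
    unfolding L1_norm_def
  proof (rule integral_mono)
    show "norm (f x - h x) \<le> norm (f x - g x) + norm (g x - h x)" for x
      using norm_triangle_ineq[of "f x - g x" "g x - h x"] by simp
  qed (intro Bochner_Integration.integrable_add integrable_norm_L1_diff assms)+
  then show ?thesis
    unfolding L1_norm_def
    by (subst (asm) Bochner_Integration.integral_add) (intro integrable_norm_L1_diff assms)+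
qed

lemma set_integral_le_L1_norm:
  fixes f :: "'a \<Rightarrow> 'e::banach"
  assumes "f \<in> L1_space M" "A \<in> sets M"
  shows "(LINT x:A|M. norm (f x)) \<le> L1_norm M f"
  unfolding L1_norm_def set_lebesgue_integral_def
  using assms by (intro integral_mono integrable_mult_indicator integrable_norm_L1) (auto split: split_indicator)

lemma norm_mean_on_diff_le:
  fixes f g :: "'a \<Rightarrow> 'e::banach"
  assumes "f \<in> L1_space M" "g \<in> L1_space M" "A \<in> sets M"
  shows "norm (mean_on M A f - mean_on M A g) \<le> (1 / measure M A) * (LINT x:A|M. norm (f x - g x))"
proof -
  have "mean_on M A f - mean_on M A g =
      (1 / measure M A) *\<^sub>R Bochner_integral M (\<lambda>x. indicator A x *\<^sub>R f x - indicator A x *\<^sub>R g x)"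
    unfolding mean_on_def using assms by (simp add: L1_diff L1_indicator scaleR_diff_right)
  also have "norm \<dots> \<le> (1 / measure M A) * L1_norm M (\<lambda>x. indicator A x *\<^sub>R f x - indicator A x *\<^sub>R g x)"
    using norm_Bochner_integral_le[OF L1_diff(1)[OF L1_indicator L1_indicator], OF assms(1,3) assms(2,3)]
    by (simp add: divide_right_mono)
  also have "L1_norm M (\<lambda>x. indicator A x *\<^sub>R f x - indicator A x *\<^sub>R g x) = (LINT x:A|M. norm (f x - g x))"
    unfolding L1_norm_def set_lebesgue_integral_def
    by (intro Bochner_Integration.integral_cong) (auto split: split_indicator)
  finally show ?thesis .
qed

lemma mean_on_const:
  "A \<in> sets M \<Longrightarrow> measure M A > 0 \<Longrightarrow> mean_on M A (\<lambda>x. v) = v"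
  by (simp add: mean_on_def Bochner_integral_indicator_const)

lemma set_integral_norm_diff_triangle:
  fixes f :: "'a \<Rightarrow> 'e::banach"
  assumes f: "f \<in> L1_space M" and A: "A \<in> sets M"
  shows "(LINT x:A|M. norm (f x - v)) \<le> (LINT x:A|M. norm (f x - w)) + measure M A * norm (w - v)"
proof -
  have c: "set_integrable M A (\<lambda>x. norm (w - v))"
    unfolding set_integrable_def using A by (intro integrable_mult_indicator) auto
  have "(LINT x:A|M. norm (f x - v)) \<le> (LINT x:A|M. norm (f x - w) + norm (w - v))"
  proof (rule set_integral_mono)
    show "norm (f x - v) \<le> norm (f x - w) + norm (w - v)" for x
      using norm_triangle_ineq[of "f x - w" "w - v"] by simp
  qed (intro set_integral_add c set_integrable_norm_L1_diff[OF f L1_const A])+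
  also have "\<dots> = (LINT x:A|M. norm (f x - w)) + (LINT x:A|M. norm (w - v))"
    by (intro set_integral_add c set_integrable_norm_L1_diff[OF f L1_const A])
  also have "(LINT x:A|M. norm (w - v)) = measure M A * norm (w - v)"
    using A by (simp add: set_lebesgue_integral_def mult.commute sets.sets_into_space Int_absorb2)
  finally show ?thesis .
qed

text \<open>Up to a factor 2 the mean is the best constant approximation: passing from
  \<open>v\<close> to the mean costs their distance, which is itself at most the average of
  \<open>norm (f x - v)\<close>. This is the origin of the factor 1/2 in the proof of the Bocce
  criterion.\<close>

lemma Bocce_osc_le:
  fixes f :: "'a \<Rightarrow> 'e::banach"
  assumes f: "f \<in> L1_space M" and A: "A \<in> sets M" "measure M A > 0"
  shows "Bocce_osc M f A \<le> 2 / measure M A * (LINT x:A|M. norm (f x - v))"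
proof -
  have "norm (v - mean_on M A f) \<le> (1 / measure M A) * (LINT x:A|M. norm (f x - v))"
    using norm_mean_on_diff_le[OF f L1_const A(1), of v] mean_on_const[OF A, of v]
    by (simp add: norm_minus_commute[of v "mean_on M A f"])
  then have "measure M A * norm (v - mean_on M A f) \<le> (LINT x:A|M. norm (f x - v))"
    using A(2) by (simp add: field_simps)
  then have "(LINT x:A|M. norm (f x - mean_on M A f)) \<le> 2 * (LINT x:A|M. norm (f x - v))"
    using set_integral_norm_diff_triangle[OF f A(1), of "mean_on M A f" v] by simp
  then show ?thesis using A(2) by (simp add: Bocce_osc_def field_simps)
qed

lemma set_integral_norm_diff_le_Bocce_osc:
  fixes f :: "'a \<Rightarrow> 'e::banach"
  assumes f: "f \<in> L1_space M" and A: "A \<in> sets M"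
  shows "(LINT x:A|M. norm (f x - a)) \<le> measure M A * (Bocce_osc M f A + norm (mean_on M A f - a))"
proof (cases "measure M A = 0")
  \<comment> \<open>On a null set the oscillation is 0 by convention, so the bound cannot come from
    unfolding it; the left side vanishes as an integral over a null set.\<close>
  case True
  then have "A \<in> null_sets M" using A by (simp add: null_sets_def emeasure_eq_measure)
  then have "AE x in M. x \<notin> A" by (rule AE_not_in)
  then have "(LINT x:A|M. norm (f x - a)) = (LINT x|M. 0)"
    unfolding set_lebesgue_integral_def
    using A borel_measurable_strongly_norm[OF strongly_measurable_diff[OF strongly_measurable_L1[OF f] strongly_measurable_const]]
    by (intro integral_cong_AE) auto
  then show ?thesis using True by simp
next
  case False
  then have "measure M A * Bocce_osc M f A = (LINT x:A|M. norm (f x - mean_on M A f))"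
    by (simp add: Bocce_osc_def)
  then show ?thesis
    using set_integral_norm_diff_triangle[OF f A, of a "mean_on M A f"] by (simp add: distrib_left)
qed

text \<open>The sets \<open>R n - R (Suc n)\<close> may be null: there \<^const>\<open>Bocce_osc\<close> is \<open>0\<close> because \<open>1 / 0 = 0\<close>.\<close>

lemma ultrafilter_exhaustion:
  fixes U :: "('a \<Rightarrow> 'e::banach) filter"
  assumes U: "ultrafilter U" "eventually (\<lambda>f. f \<in> K) U" and bocce: "Bocce_criterion M K" and \<epsilon>: "\<epsilon> > 0"
  obtains R where "R 0 = space M" "\<And>n. R n \<in> sets M" "decseq R" "(\<lambda>n. measure M (R n)) \<longlonglongrightarrow> 0"
    "\<And>n. eventually (\<lambda>f. Bocce_osc M f (R n - R (Suc n)) < \<epsilon>) U"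
proof -
  define good where "good A \<longleftrightarrow> A \<in> sets M \<and> eventually (\<lambda>f. Bocce_osc M f A < \<epsilon>) U" for A
  have good_empty: "good {}" using \<epsilon> by (simp add: good_def Bocce_osc_def)
  have ex_good: "\<exists>A. good A \<and> A \<subseteq> B \<and> measure M A > 0" if B: "B \<in> sets M" "measure M B > 0" for B
  proof -
    have "B \<in> positive_sets M (space M)" using B sets.sets_into_space by (auto simp: positive_sets_def)
    then obtain \<A> where \<A>: "finite \<A>" "\<A> \<subseteq> positive_sets M B" "\<forall>f\<in>K. \<exists>A\<in>\<A>. Bocce_osc M f A < \<epsilon>"
      using bocce[unfolded Bocce_criterion_def, rule_format, OF \<epsilon>] by metis
    have "eventually (\<lambda>f. \<exists>A\<in>\<A>. Bocce_osc M f A < \<epsilon>) U"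
      using U(2) by eventually_elim (use \<A>(3) in blast)
    then obtain A where "A \<in> \<A>" "eventually (\<lambda>f. Bocce_osc M f A < \<epsilon>) U"
      using ultrafilter_finite_exD[OF U(1) \<A>(1), of "\<lambda>A f. Bocce_osc M f A < \<epsilon>"] by blast
    then show ?thesis using \<A>(2) by (auto simp: good_def positive_sets_def)
  qed
  let ?P = "\<lambda>n R. R \<in> sets M \<and> (n = 0 \<longrightarrow> R = space M)"
  \<comment> \<open>Greedy choice: the removed set has at least half the measure of any good set
    still available, since the supremum itself need not be attained.\<close>
  let ?Q = "\<lambda>R R'. R' \<subseteq> R \<and> good (R - R') \<and> (\<forall>A. good A \<and> A \<subseteq> R \<longrightarrow> measure M A \<le> 2 * measure M (R - R'))"
  have "\<exists>R. \<forall>n::nat. ?P n (R n) \<and> ?Q (R n) (R (Suc n))"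
  proof (rule dependent_nat_choice)
    show "\<exists>R. ?P 0 R" by blast
    fix R and n :: nat assume "?P n R"
    then have R: "R \<in> sets M" by blast
    define S where "S = measure M ` {A. good A \<and> A \<subseteq> R}"
    have S: "S \<noteq> {}" "bdd_above S"
      using good_empty by (auto simp: S_def good_def bounded_measure intro!: bdd_aboveI[of _ "measure M (space M)"])
    have le: "measure M A \<le> Sup S" if "good A" "A \<subseteq> R" for A
      using that S(2) by (intro cSup_upper) (auto simp: S_def)
    have nonneg: "Sup S \<ge> 0" using le[OF good_empty] by simp
    show "\<exists>R'. ?P (Suc n) R' \<and> ?Q R R'"
    proof (cases "Sup S = 0")
      case True
      \<comment> \<open>All good sets left are null, so it is enough to remove the empty
        set.\<close>
      then show ?thesis using R good_empty le by (intro exI[of _ R]) auto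
    next
      case False
      then have "Sup S / 2 < Sup S" using nonneg by simp
      then obtain A where A: "good A" "A \<subseteq> R" "Sup S / 2 < measure M A"
        using less_cSup_iff[OF S, of "Sup S / 2"] unfolding S_def by blast
      have "R - (R - A) = A" using A(2) by blast
      moreover have "measure M B \<le> 2 * measure M A" if "good B" "B \<subseteq> R" for B
        using le[OF that] A(3) by simp
      ultimately show ?thesis using A R by (intro exI[of _ "R - A"]) (auto simp: good_def)
    qed
  qed
  then obtain R where R': "\<forall>n. ?P n (R n) \<and> ?Q (R n) (R (Suc n))" by (rule exE)
  have R: "R n \<in> sets M" "R 0 = space M" "R (Suc n) \<subseteq> R n" "good (R n - R (Suc n))" for n
    using R' by simp_all
  have R_max: "measure M A \<le> 2 * measure M (R n - R (Suc n))" if "good A" "A \<subseteq> R n" for n A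
    using R' that by simp
  have dec: "decseq R" using R(3) by (rule decseq_SucI)
  have lim: "(\<lambda>n. measure M (R n)) \<longlonglongrightarrow> measure M (\<Inter>n. R n)"
    using R(1) dec by (intro finite_Lim_measure_decseq) auto
  have "measure M (\<Inter>n. R n) = 0"
  proof (rule ccontr)
    assume "measure M (\<Inter>n. R n) \<noteq> 0"
    then have "measure M (\<Inter>n. R n) > 0" by (simp add: zero_less_measure_iff)
    then obtain A where A: "good A" "A \<subseteq> (\<Inter>n. R n)" "measure M A > 0"
      using ex_good[of "\<Inter>n. R n"] R(1) by auto
    \<comment> \<open>\<open>A\<close> is a candidate at every stage, so each removed piece has at
      least half its measure. But the removed measures are differences of a convergent sequence and
      tend to 0.\<close>
    have "measure M A \<le> 2 * (measure M (R n) - measure M (R (Suc n)))" for n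
      using R_max[OF A(1), of n] A(2) finite_measure_Diff[OF R(1) R(1) R(3), of n] by auto
    moreover have "(\<lambda>n. 2 * (measure M (R n) - measure M (R (Suc n)))) \<longlonglongrightarrow> 2 * (measure M (\<Inter>n. R n) - measure M (\<Inter>n. R n))"
      by (intro tendsto_intros lim LIMSEQ_Suc[OF lim])
    ultimately have "measure M A \<le> 2 * (measure M (\<Inter>n. R n) - measure M (\<Inter>n. R n))"
      by (intro LIMSEQ_le_const) auto
    then show False using A(3) by simp
  qed
  then show ?thesis using that[of R] R dec lim by (auto simp: good_def)
qed

text \<open>A finite \<epsilon>-net of the means and the pigeonhole principle yield
  \<open>a\<close>. For a null set the compactness hypothesis says nothing, but all means are 0
  there.\<close>

lemma ultrafilter_mean_on_near:
  fixes U :: "('a \<Rightarrow> 'e::banach) filter"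
  assumes U: "ultrafilter U" "eventually (\<lambda>f. f \<in> K) U" and A: "A \<in> sets M" and \<epsilon>: "\<epsilon> > 0"
    and means: "\<And>B. B \<in> positive_sets M (space M) \<Longrightarrow> relatively_compactin euclidean {mean_on M B f | f. f \<in> K}"
  shows "\<exists>a. eventually (\<lambda>f. norm (mean_on M A f - a) < \<epsilon>) U"
proof (cases "measure M A = 0")
  case True
  then show ?thesis using \<epsilon> by (intro exI[of _ 0]) (simp add: mean_on_def)
next
  case False
  then have "A \<in> positive_sets M (space M)"
    using A sets.sets_into_space by (auto simp: positive_sets_def zero_less_measure_iff)
  then have "compact (closure {mean_on M A f | f. f \<in> K})"
    using means by (simp add: relatively_compactin_def)
  then obtain k where k: "finite k" "closure {mean_on M A f | f. f \<in> K} \<subseteq> (\<Union>x\<in>k. ball x \<epsilon>)"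
    using \<epsilon> unfolding compact_eq_totally_bounded by blast
  have "eventually (\<lambda>f. \<exists>a\<in>k. norm (mean_on M A f - a) < \<epsilon>) U"
    using U(2)
  proof eventually_elim
    case (elim f)
    then have "mean_on M A f \<in> {mean_on M A f | f. f \<in> K}" by blast
    then have "mean_on M A f \<in> (\<Union>x\<in>k. ball x \<epsilon>)" by (rule subsetD[OF order_trans[OF closure_subset k(2)]])
    then show ?case by (auto simp: dist_norm norm_minus_commute)
  qed
  then show ?thesis using ultrafilter_finite_exD[OF U(1) k(1), of "\<lambda>a f. norm (mean_on M A f - a) < \<epsilon>"] by blast
qed

text \<open>Uniform absolute continuity of the integrals, tested only along decreasing sequences of
  sets with measure tending to 0: this is the form in which the exhaustion uses it and the gliding
  hump provides it.\<close>

definition equi_absolutely_continuous :: "('a \<Rightarrow> 'e::banach) set \<Rightarrow> bool" where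
  "equi_absolutely_continuous K \<longleftrightarrow> (\<forall>R. range R \<subseteq> sets M \<longrightarrow> decseq R \<longrightarrow> (\<lambda>n. measure M (R n)) \<longlonglongrightarrow> 0 \<longrightarrow>
     (\<forall>\<epsilon>>0. \<exists>n. \<forall>f\<in>K. (LINT x:R n|M. norm (f x)) < \<epsilon>))"

text \<open>On each removed set \<open>A\<close> the constant \<open>a\<close> is within
  \<open>2 * \<delta> * measure M A\<close> of almost all \<open>f\<close>: one \<delta> for the
  oscillation, one for the distance from the mean to \<open>a\<close>. These errors add up to at
  most \<epsilon>/2, and the mass on the remaining set is below \<epsilon>/2.\<close>

lemma ultrafilter_near_simple_function:
  fixes U :: "('a \<Rightarrow> 'e::banach) filter"
  assumes U: "ultrafilter U" "eventually (\<lambda>f. f \<in> K) U" and K: "K \<subseteq> L1_space M"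
    and bocce: "Bocce_criterion M K" and eac: "equi_absolutely_continuous K"
    and means: "\<And>B. B \<in> positive_sets M (space M) \<Longrightarrow> relatively_compactin euclidean {mean_on M B f | f. f \<in> K}"
    and \<epsilon>: "\<epsilon> > 0"
  shows "\<exists>h. simple_function M h \<and> eventually (\<lambda>f. L1_norm M (\<lambda>x. f x - h x) < \<epsilon>) U"
proof -
  \<comment> \<open>The 4 makes the total error \<open>2 * \<delta> * measure M (space M)\<close> at
    most \<epsilon>/2; the added 1 keeps the denominator positive.\<close>
  define \<delta> where "\<delta> = \<epsilon> / (4 * (measure M (space M) + 1))"
  have \<delta>: "\<delta> > 0" using \<epsilon> by (simp add: \<delta>_def add_nonneg_pos)
  have \<delta>_le: "2 * \<delta> * measure M A \<le> \<epsilon> / 2" if "A \<in> sets M" for A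
  proof -
    have "2 * \<delta> * measure M A \<le> 2 * \<delta> * (measure M (space M) + 1)"
      using \<delta> bounded_measure[of A] by (intro mult_left_mono) auto
    also have "\<dots> = \<epsilon> / 2"
      using measure_nonneg[of M "space M"] by (simp add: \<delta>_def field_simps add_nonneg_eq_0_iff)
    finally show ?thesis .
  qed
  obtain R where R: "R 0 = space M" "\<And>n. R n \<in> sets M" "decseq R" "(\<lambda>n. measure M (R n)) \<longlonglongrightarrow> 0"
    "\<And>n. eventually (\<lambda>f. Bocce_osc M f (R n - R (Suc n)) < \<delta>) U"
    using ultrafilter_exhaustion[OF U bocce \<delta>] by blast
  \<comment> \<open>A filter admits finitely many eventual conditions at once, not countably many.
    Hence the simple function is built for each finite stage, and the stage is fixed
    afterwards.\<close>
  have ex_h: "\<exists>h. simple_function M h \<and> (\<forall>x\<in>R n. h x = 0) \<and>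
      eventually (\<lambda>f. (LINT x:space M - R n|M. norm (f x - h x)) \<le> 2 * \<delta> * measure M (space M - R n)) U" for n
  proof (induction n)
    case 0
    show ?case by (intro exI[of _ "\<lambda>_. 0"]) (simp add: R(1) set_lebesgue_integral_def)
  next
    case (Suc n)
    then obtain h where h: "simple_function M h" "\<And>x. x \<in> R n \<Longrightarrow> h x = 0"
      "eventually (\<lambda>f. (LINT x:space M - R n|M. norm (f x - h x)) \<le> 2 * \<delta> * measure M (space M - R n)) U"
      by blast
    define A where "A = R n - R (Suc n)"
    have A: "A \<in> sets M" using R(2) by (simp add: A_def)
    obtain a where a: "eventually (\<lambda>f. norm (mean_on M A f - a) < \<delta>) U"
      using ultrafilter_mean_on_near[OF U A \<delta> means] by blast
    define h' where "h' x = (if x \<in> A then a else h x)" for x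
    have sub: "R (Suc n) \<subseteq> R n" using R(3) by (simp add: decseq_Suc_iff)
    have split: "space M - R (Suc n) = (space M - R n) \<union> A" "(space M - R n) \<inter> A = {}"
      using sub sets.sets_into_space[OF R(2)[of n]] by (auto simp: A_def)
    have simple: "simple_function M h'"
      unfolding h'_def using A by (intro simple_function_If_set h) auto
    have zero: "h' x = 0" if "x \<in> R (Suc n)" for x
      using that sub h(2) by (auto simp: h'_def A_def)
    have "eventually (\<lambda>f. Bocce_osc M f A < \<delta>) U" using R(5) by (simp add: A_def)
    then have "eventually (\<lambda>f. (LINT x:space M - R (Suc n)|M. norm (f x - h' x)) \<le> 2 * \<delta> * measure M (space M - R (Suc n))) U"
      using h(3) a U(2)
    proof eventually_elim
      case (elim f)
      then have f: "f \<in> L1_space M" using K by blast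
      have meas: "space M - R n \<in> sets M" using R(2) by auto
      have "(LINT x:space M - R (Suc n)|M. norm (f x - h' x)) =
          (LINT x:space M - R n|M. norm (f x - h' x)) + (LINT x:A|M. norm (f x - h' x))"
        unfolding split(1)
        by (rule set_integral_Un[OF split(2)])
          (intro set_integrable_norm_L1_diff f L1_simple_function simple A meas)+
      also have "(LINT x:space M - R n|M. norm (f x - h' x)) = (LINT x:space M - R n|M. norm (f x - h x))"
        using split(2) by (intro set_lebesgue_integral_cong[OF meas]) (auto simp: h'_def)
      also have "(LINT x:A|M. norm (f x - h' x)) = (LINT x:A|M. norm (f x - a))"
        by (intro set_lebesgue_integral_cong[OF A]) (auto simp: h'_def)
      also have "\<dots> \<le> measure M A * (Bocce_osc M f A + norm (mean_on M A f - a))"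
        by (rule set_integral_norm_diff_le_Bocce_osc[OF f A])
      also have "\<dots> \<le> measure M A * (2 * \<delta>)"
        using elim by (intro mult_left_mono) auto
      finally have "(LINT x:space M - R (Suc n)|M. norm (f x - h' x)) \<le>
          2 * \<delta> * (measure M (space M - R n) + measure M A)"
        using elim by (simp add: algebra_simps)
      also have "measure M (space M - R n) + measure M A = measure M (space M - R (Suc n))"
        unfolding split(1) by (rule finite_measure_Union[OF meas A split(2), symmetric])
      finally show ?case .
    qed
    then show ?case using simple zero by blast
  qed
  \<comment> \<open>The stage depends on \<open>R\<close> and \<epsilon> only and serves all
    \<open>f\<close> in \<open>K\<close>, so it is compatible with the eventual conditions.\<close>
  obtain n where n: "\<And>f. f \<in> K \<Longrightarrow> (LINT x:R n|M. norm (f x)) < \<epsilon> / 2"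
    using eac R(2,3,4) \<epsilon> unfolding equi_absolutely_continuous_def
    by (metis half_gt_zero image_subsetI)
  obtain h where h: "simple_function M h" "\<And>x. x \<in> R n \<Longrightarrow> h x = 0"
      "eventually (\<lambda>f. (LINT x:space M - R n|M. norm (f x - h x)) \<le> 2 * \<delta> * measure M (space M - R n)) U"
    using ex_h[of n] by blast
  have "eventually (\<lambda>f. L1_norm M (\<lambda>x. f x - h x) < \<epsilon>) U"
    using h(3) U(2)
  proof eventually_elim
    case (elim f)
    then have f: "f \<in> L1_space M" using K by blast
    have meas: "space M - R n \<in> sets M" using R(2) by auto
    have "L1_norm M (\<lambda>x. f x - h x) = (LINT x:(space M - R n) \<union> R n|M. norm (f x - h x))"
      using sets.sets_into_space[OF R(2)[of n]] integrable_norm_L1_diff[OF f L1_simple_function(1)[OF h(1)]]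
      by (simp add: L1_norm_def Un_absorb2 set_integral_space)
    also have "\<dots> = (LINT x:space M - R n|M. norm (f x - h x)) + (LINT x:R n|M. norm (f x - h x))"
      by (rule set_integral_Un) (blast, (intro set_integrable_norm_L1_diff f L1_simple_function h meas R)+)
    also have "(LINT x:R n|M. norm (f x - h x)) = (LINT x:R n|M. norm (f x))"
      using h(2) by (intro set_lebesgue_integral_cong[OF R(2)]) auto
    also have "\<dots> < \<epsilon> / 2" using n elim by blast
    finally show ?case using elim \<delta>_le[OF meas] by simp
  qed
  then show ?thesis using h(1) by blast
qed

text \<open>If finitely many balls about simple functions never covered \<open>K\<close>, an
  ultrafilter on \<open>K\<close> would avoid all of them, although some such ball contains almost
  all of its points.\<close>

lemma ex_finite_simple_function_net:
  fixes K :: "('a \<Rightarrow> 'e::banach) set"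
  assumes K: "K \<subseteq> L1_space M"
    and bocce: "Bocce_criterion M K" and eac: "equi_absolutely_continuous K"
    and means: "\<And>B. B \<in> positive_sets M (space M) \<Longrightarrow> relatively_compactin euclidean {mean_on M B f | f. f \<in> K}"
    and \<epsilon>: "\<epsilon> > 0"
  shows "\<exists>H. finite H \<and> (\<forall>h\<in>H. simple_function M h) \<and> (\<forall>f\<in>K. \<exists>h\<in>H. L1_norm M (\<lambda>x. f x - h x) < \<epsilon>)"
proof -
  let ?b = "\<lambda>h. {f. L1_norm M (\<lambda>x. f x - h x) < \<epsilon>}"
  have "\<exists>\<F>. finite \<F> \<and> \<F> \<subseteq> ?b ` Collect (simple_function M) \<and> K \<subseteq> \<Union>\<F>"
  proof (rule ccontr)
    assume "\<not> ?thesis"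
    then have no_cover: "\<not> K \<subseteq> \<Union>\<F>" if "finite \<F>" "\<F> \<subseteq> ?b ` Collect (simple_function M)" for \<F>
      using that by blast
    show False
    proof (rule ultrafilter_disjoint_finite_covers[OF no_cover])
      fix U assume U: "ultrafilter U" "eventually (\<lambda>f. f \<in> K) U"
        and none: "\<And>A. A \<in> ?b ` Collect (simple_function M) \<Longrightarrow> \<not> eventually (\<lambda>f. f \<in> A) U"
      obtain h where "simple_function M h" "eventually (\<lambda>f. f \<in> ?b h) U"
        using ultrafilter_near_simple_function[OF U K bocce eac means \<epsilon>] by auto
      then show False using none[of "?b h"] by simp
    qed
  qed
  then obtain \<F> where \<F>: "finite \<F>" "\<F> \<subseteq> ?b ` Collect (simple_function M)" "K \<subseteq> \<Union>\<F>" by blast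
  then obtain H where "H \<subseteq> Collect (simple_function M)" "finite H" "\<F> = ?b ` H"
    by (meson finite_subset_image)
  then show ?thesis using \<F>(3) by (intro exI[of _ H]) blast
qed

section \<open>Norm topology\<close>

lemma L1_norm_zero: "L1_norm M (\<lambda>x. 0) = 0"
  by (simp add: L1_norm_def)

lemma openin_L1_ball:
  fixes f :: "'a \<Rightarrow> 'e::banach"
  assumes "f \<in> L1_space M" "r > 0"
  shows "openin (L1_norm_topology M) {g \<in> L1_space M. L1_norm M (\<lambda>x. g x - f x) < r}"
  unfolding L1_norm_topology_def using assms by (intro topology_generated_by_Basis) blast

lemma topspace_L1_norm_topology: "topspace (L1_norm_topology M) = (L1_space M :: ('a \<Rightarrow> 'e::banach) set)"
proof -
  have "(L1_space M :: ('a \<Rightarrow> 'e) set) \<subseteq> topspace (L1_norm_topology M)"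
  proof
    fix f :: "'a \<Rightarrow> 'e" assume "f \<in> L1_space M"
    then have "f \<in> {g \<in> L1_space M. L1_norm M (\<lambda>x. g x - f x) < 1}"
      "openin (L1_norm_topology M) {g \<in> L1_space M. L1_norm M (\<lambda>x. g x - f x) < 1}"
      using openin_L1_ball[of f 1] by (auto simp: L1_norm_zero)
    then show "f \<in> topspace (L1_norm_topology M)" using openin_subset by blast
  qed
  then show ?thesis by (auto simp: L1_norm_topology_def)
qed

text \<open>The defining balls are formally only a subbasis. The triangle inequality puts a ball
  around each point of each of them, so they form a basis.\<close>

lemma openin_L1_norm_topology:
  fixes U :: "('a \<Rightarrow> 'e::banach) set"
  shows "openin (L1_norm_topology M) U \<longleftrightarrow>
    U \<subseteq> L1_space M \<and> (\<forall>f\<in>U. \<exists>r>0. \<forall>g\<in>L1_space M. L1_norm M (\<lambda>x. g x - f x) < r \<longrightarrow> g \<in> U)"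
proof
  assume U: "openin (L1_norm_topology M) U"
  then have "generate_topology_on
     {{g \<in> L1_space M. L1_norm M (\<lambda>x. g x - f x) < r} | f r. f \<in> L1_space M \<and> 0 < r} U"
    unfolding L1_norm_topology_def by (simp add: openin_topology_generated_by_iff)
  then have "\<forall>f\<in>U. \<exists>r>0. \<forall>g\<in>L1_space M. L1_norm M (\<lambda>x. g x - f x) < r \<longrightarrow> g \<in> U"
  proof induction
    case Empty
    then show ?case by simp
  next
    case (Int U V)
    show ?case
    proof
      fix f assume f: "f \<in> U \<inter> V"
      obtain r where r: "r > 0" "\<forall>g\<in>L1_space M. L1_norm M (\<lambda>x. g x - f x) < r \<longrightarrow> g \<in> U" using Int.IH(1) f by blast
      obtain s where s: "s > 0" "\<forall>g\<in>L1_space M. L1_norm M (\<lambda>x. g x - f x) < s \<longrightarrow> g \<in> V" using Int.IH(2) f by blast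
      show "\<exists>r>0. \<forall>g\<in>L1_space M. L1_norm M (\<lambda>x. g x - f x) < r \<longrightarrow> g \<in> U \<inter> V"
        using r s by (intro exI[of _ "min r s"]) auto
    qed
  next
    case (UN \<U>)
    then show ?case by (meson Union_iff)
  next
    case (Basis U)
    then obtain f r where U: "U = {g \<in> L1_space M. L1_norm M (\<lambda>x. g x - f x) < r}" "f \<in> L1_space M" by blast
    show ?case
    proof
      fix g assume "g \<in> U"
      then have g: "g \<in> L1_space M" "L1_norm M (\<lambda>x. g x - f x) < r" by (auto simp: U)
      show "\<exists>s>0. \<forall>h\<in>L1_space M. L1_norm M (\<lambda>x. h x - g x) < s \<longrightarrow> h \<in> U"
      proof (intro exI[of _ "r - L1_norm M (\<lambda>x. g x - f x)"] conjI ballI impI)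
        fix h assume "h \<in> L1_space M" "L1_norm M (\<lambda>x. h x - g x) < r - L1_norm M (\<lambda>x. g x - f x)"
        then show "h \<in> U" using L1_norm_triangle[OF _ g(1) U(2), of h] by (simp add: U)
      qed (use g in simp)
    qed
  qed
  then show "U \<subseteq> L1_space M \<and> (\<forall>f\<in>U. \<exists>r>0. \<forall>g\<in>L1_space M. L1_norm M (\<lambda>x. g x - f x) < r \<longrightarrow> g \<in> U)"
    using openin_subset[OF U] by (simp add: topspace_L1_norm_topology)
next
  assume U: "U \<subseteq> L1_space M \<and> (\<forall>f\<in>U. \<exists>r>0. \<forall>g\<in>L1_space M. L1_norm M (\<lambda>x. g x - f x) < r \<longrightarrow> g \<in> U)"
  show "openin (L1_norm_topology M) U"
  proof (subst openin_subopen, intro ballI)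
    fix f assume f: "f \<in> U"
    then obtain r where r: "r > 0" "\<forall>g\<in>L1_space M. L1_norm M (\<lambda>x. g x - f x) < r \<longrightarrow> g \<in> U" using U by blast
    let ?V = "{g \<in> L1_space M. L1_norm M (\<lambda>x. g x - f x) < r}"
    have "openin (L1_norm_topology M) ?V"
      unfolding L1_norm_topology_def using f U r(1) by (intro topology_generated_by_Basis) blast
    then show "\<exists>T. openin (L1_norm_topology M) T \<and> f \<in> T \<and> T \<subseteq> U"
      using f U r by (intro exI[of _ ?V]) (auto simp: L1_norm_zero)
  qed
qed

lemma continuous_map_L1_Lipschitz:
  fixes F :: "('a \<Rightarrow> 'e::banach) \<Rightarrow> 'b::real_normed_vector"
  assumes F: "\<And>f g. f \<in> L1_space M \<Longrightarrow> g \<in> L1_space M \<Longrightarrow> norm (F g - F f) \<le> C * L1_norm M (\<lambda>x. g x - f x)"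
  shows "continuous_map (L1_norm_topology M) euclidean F"
  unfolding continuous_map_def topspace_L1_norm_topology
proof (intro conjI allI impI)
  fix U :: "'b set" assume "openin euclidean U"
  then have U: "open U" by simp
  show "openin (L1_norm_topology M) {f \<in> L1_space M. F f \<in> U}"
    unfolding openin_L1_norm_topology
  proof (intro conjI ballI)
    fix f assume "f \<in> {f \<in> L1_space M. F f \<in> U}"
    then have f: "f \<in> L1_space M" "F f \<in> U" by auto
    then obtain e where e: "e > 0" "ball (F f) e \<subseteq> U" using U open_contains_ball by blast
    \<comment> \<open>The Lipschitz constant is enlarged to a positive one so that
      \<open>e / D\<close> is a radius; \<open>C\<close> can be 0, as for the mean over a null
      set.\<close>
    define D where "D = max C 1"
    have D: "D > 0" "C \<le> D" by (auto simp: D_def)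
    show "\<exists>r>0. \<forall>g\<in>L1_space M. L1_norm M (\<lambda>x. g x - f x) < r \<longrightarrow> g \<in> {f \<in> L1_space M. F f \<in> U}"
    proof (intro exI[of _ "e / D"] conjI ballI impI)
      fix g assume g: "g \<in> L1_space M" "L1_norm M (\<lambda>x. g x - f x) < e / D"
      have "norm (F g - F f) \<le> C * L1_norm M (\<lambda>x. g x - f x)" by (rule F[OF f(1) g(1)])
      also have "\<dots> \<le> D * L1_norm M (\<lambda>x. g x - f x)" using D by (intro mult_right_mono) (auto simp: L1_norm_def)
      also have "\<dots> < e" using g(2) D by (simp add: field_simps)
      finally have "F g \<in> ball (F f) e" by (simp add: dist_norm norm_minus_commute)
      then show "g \<in> {f \<in> L1_space M. F f \<in> U}" using g(1) e(2) by blast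
    qed (use e D in simp)
  qed simp
qed auto

text \<open>The Riesz-Fischer argument: the increments have a finite sum of norms almost everywhere,
  which gives a pointwise limit, and Fatou's lemma turns the Cauchy estimate into convergence in the
  seminorm. Starting from simple functions makes the limit strongly measurable by
  definition.\<close>

lemma L1_complete_simple:
  fixes s :: "nat \<Rightarrow> 'a \<Rightarrow> 'e::banach"
  assumes s: "\<And>n. simple_function M (s n)"
    and dist: "\<And>n. L1_norm M (\<lambda>x. s (Suc n) x - s n x) \<le> C * (1 / 2) ^ n"
  shows "\<exists>g\<in>L1_space M. (\<lambda>n. L1_norm M (\<lambda>x. g x - s n x)) \<longlonglongrightarrow> 0"
proof -
  note L1 = L1_simple_function(1)[OF s]
  define d where "d n x = norm (s (Suc n) x - s n x)" for n x
  have d_int: "integrable M (d n)" for n unfolding d_def by (rule integrable_norm_L1_diff[OF L1 L1])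
  then have [measurable]: "d n \<in> borel_measurable M" for n by (rule borel_measurable_integrable)
  define G where "G = {x \<in> space M. (\<Sum>n. ennreal (d n x)) < \<infinity>}"
  have G: "G \<in> sets M" unfolding G_def by measurable
  have "(\<integral>\<^sup>+x. (\<Sum>n. ennreal (d n x)) \<partial>M) = (\<Sum>n. \<integral>\<^sup>+x. ennreal (d n x) \<partial>M)"
    by (intro nn_integral_suminf) measurable
  also have "\<dots> = (\<Sum>n. ennreal (L1_norm M (\<lambda>x. s (Suc n) x - s n x)))"
  proof -
    have "(\<integral>\<^sup>+x. ennreal (d n x) \<partial>M) = ennreal (L1_norm M (\<lambda>x. s (Suc n) x - s n x))" for n
      using nn_integral_eq_integral[OF d_int[of n]] unfolding L1_norm_def d_def by simp
    then show ?thesis by simp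
  qed
  also have "\<dots> < \<infinity>"
  proof -
    have "summable (\<lambda>n. L1_norm M (\<lambda>x. s (Suc n) x - s n x))"
    proof (rule summable_comparison_test'[of "\<lambda>n. C * (1 / 2) ^ n" 0])
      show "summable (\<lambda>n. C * (1 / 2 :: real) ^ n)" by (intro summable_mult summable_geometric) simp
      show "norm (L1_norm M (\<lambda>x. s (Suc n) x - s n x)) \<le> C * (1 / 2) ^ n" for n
        using dist[of n] by (simp add: L1_norm_def)
    qed
    then show ?thesis by (simp add: ennreal_suminf_neq_top L1_norm_def less_top)
  qed
  finally have "AE x in M. (\<Sum>n. ennreal (d n x)) \<noteq> \<infinity>"
    by (intro nn_integral_PInf_AE) auto
  then have AE_G: "AE x in M. x \<in> G" by (auto simp: G_def less_top)
  \<comment> \<open>\<open>lim\<close> is arbitrary where the sequence diverges. With value 0 off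
    \<open>G\<close>, the function is the limit at every point of the functions \<open>s n\<close>
    cut off outside \<open>G\<close>.\<close>
  define g where "g x = (if x \<in> G then lim (\<lambda>n. s n x) else 0)" for x
  have lim: "(\<lambda>n. s n x) \<longlonglongrightarrow> g x" if x: "x \<in> G" for x
  proof -
    have "summable (\<lambda>n. d n x)"
      using x by (intro summable_suminf_not_top) (auto simp: G_def d_def)
    then have "summable (\<lambda>n. s (Suc n) x - s n x)" unfolding d_def by (rule summable_norm_cancel)
    then have "(\<lambda>n. s 0 x + (\<Sum>i<n. s (Suc i) x - s i x)) \<longlonglongrightarrow> s 0 x + (\<Sum>i. s (Suc i) x - s i x)"
      by (intro tendsto_intros summable_LIMSEQ)
    moreover have "s 0 x + (\<Sum>i<n. s (Suc i) x - s i x) = s n x" for n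
      by (simp add: sum_lessThan_telescope[of "\<lambda>i. s i x"])
    ultimately have "convergent (\<lambda>n. s n x)" by (auto simp: convergent_def)
    then show ?thesis using x by (simp add: g_def convergent_LIMSEQ_iff)
  qed
  have g: "strongly_measurable M g"
    unfolding strongly_measurable_def
  proof (intro exI[of _ "\<lambda>n x. if x \<in> G then s n x else 0"] conjI allI ballI)
    show "simple_function M (\<lambda>x. if x \<in> G then s n x else 0)" for n
      using G by (intro simple_function_If_set s) auto
    show "(\<lambda>n. if x \<in> G then s n x else 0) \<longlonglongrightarrow> g x" for x
      using lim[of x] by (cases "x \<in> G") (auto simp: g_def)
  qed
  \<comment> \<open>The bound is the exact partial geometric sum rather than its limit, so that the
    induction on \<open>k\<close> closes.\<close>
  have tail: "L1_norm M (\<lambda>x. s (n + k) x - s n x) \<le> C * (2 * (1 / 2) ^ n - 2 * (1 / 2) ^ (n + k))" for n k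
  proof (induction k)
    case 0
    then show ?case by (simp add: L1_norm_zero)
  next
    case (Suc k)
    have "L1_norm M (\<lambda>x. s (n + Suc k) x - s n x) \<le>
        L1_norm M (\<lambda>x. s (Suc (n + k)) x - s (n + k) x) + L1_norm M (\<lambda>x. s (n + k) x - s n x)"
      using L1_norm_triangle[OF L1 L1 L1] by simp
    also have "\<dots> \<le> C * (1 / 2) ^ (n + k) + C * (2 * (1 / 2) ^ n - 2 * (1 / 2) ^ (n + k))"
      by (intro add_mono dist Suc)
    also have "\<dots> = C * (2 * (1 / 2) ^ n - 2 * (1 / 2) ^ (n + Suc k))" by (simp add: algebra_simps)
    finally show ?case .
  qed
  have C: "C \<ge> 0" using order_trans[OF _ dist[of 0]] by (simp add: L1_norm_def)
  have fatou: "(\<integral>\<^sup>+x. ennreal (norm (g x - s n x)) \<partial>M) \<le> ennreal (C * (2 * (1 / 2) ^ n))" for n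
  proof -
    have "(\<integral>\<^sup>+x. ennreal (norm (g x - s n x)) \<partial>M) = (\<integral>\<^sup>+x. liminf (\<lambda>m. ennreal (norm (s m x - s n x))) \<partial>M)"
    proof (rule nn_integral_cong_AE)
      show "AE x in M. ennreal (norm (g x - s n x)) = liminf (\<lambda>m. ennreal (norm (s m x - s n x)))"
        using AE_G
      proof eventually_elim
        case (elim x)
        have "(\<lambda>m. ennreal (norm (s m x - s n x))) \<longlonglongrightarrow> ennreal (norm (g x - s n x))"
          by (intro tendsto_intros lim elim)
        then show ?case using lim_imp_Liminf by (metis trivial_limit_sequentially)
      qed
    qed
    also have "\<dots> \<le> liminf (\<lambda>m. \<integral>\<^sup>+x. ennreal (norm (s m x - s n x)) \<partial>M)"
    proof (rule nn_integral_liminf)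
      show "(\<lambda>x. ennreal (norm (s m x - s n x))) \<in> borel_measurable M" for m
        using integrable_norm_L1_diff[OF L1[of m] L1[of n]] by simp
    qed
    also have "\<dots> \<le> limsup (\<lambda>m. \<integral>\<^sup>+x. ennreal (norm (s m x - s n x)) \<partial>M)"
      by (rule Liminf_le_Limsup) simp
    also have "\<dots> \<le> ennreal (C * (2 * (1 / 2) ^ n))"
    proof (rule Limsup_bounded)
      show "eventually (\<lambda>m. (\<integral>\<^sup>+x. ennreal (norm (s m x - s n x)) \<partial>M) \<le> ennreal (C * (2 * (1 / 2) ^ n))) sequentially"
        unfolding eventually_sequentially
      proof (intro exI[of _ n] allI impI)
        fix m assume "n \<le> m"
        then obtain k where m: "m = n + k" using le_Suc_ex by blast
        have "(\<integral>\<^sup>+x. ennreal (norm (s m x - s n x)) \<partial>M) = ennreal (L1_norm M (\<lambda>x. s m x - s n x))"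
          unfolding L1_norm_def by (intro nn_integral_eq_integral integrable_norm_L1_diff L1) simp
        also have "\<dots> \<le> ennreal (C * (2 * (1 / 2) ^ n - 2 * (1 / 2) ^ (n + k)))"
          using tail[of n k] by (intro ennreal_leI) (simp add: m)
        also have "\<dots> \<le> ennreal (C * (2 * (1 / 2) ^ n))"
          using C by (intro ennreal_leI mult_left_mono) auto
        finally show "(\<integral>\<^sup>+x. ennreal (norm (s m x - s n x)) \<partial>M) \<le> ennreal (C * (2 * (1 / 2) ^ n))" .
      qed
    qed
    finally show ?thesis .
  qed
  have int: "integrable M (\<lambda>x. norm (g x - s n x))" for n
  proof (rule integrableI_bounded)
    show "(\<lambda>x. norm (g x - s n x)) \<in> borel_measurable M"
      by (intro borel_measurable_strongly_norm strongly_measurable_diff g strongly_measurable_simple_function s)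
    show "(\<integral>\<^sup>+x. ennreal (norm (norm (g x - s n x))) \<partial>M) < \<infinity>"
      using fatou[of n] by (simp add: le_less_trans[OF _ ennreal_less_top])
  qed
  have "L1_norm M (\<lambda>x. g x - s n x) \<le> C * (2 * (1 / 2) ^ n)" for n
  proof -
    have "ennreal (L1_norm M (\<lambda>x. g x - s n x)) \<le> ennreal (C * (2 * (1 / 2) ^ n))"
      unfolding L1_norm_def using fatou[of n] nn_integral_eq_integral[OF int[of n]] by simp
    then show ?thesis using C by (subst (asm) ennreal_le_iff) auto
  qed
  then have bound: "eventually (\<lambda>n. L1_norm M (\<lambda>x. g x - s n x) \<le> C * (2 * (1 / 2) ^ n)) sequentially" by simp
  have lim0: "(\<lambda>n. L1_norm M (\<lambda>x. g x - s n x)) \<longlonglongrightarrow> 0"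
  proof (rule tendsto_sandwich[OF _ bound tendsto_const])
    show "eventually (\<lambda>n. 0 \<le> L1_norm M (\<lambda>x. g x - s n x)) sequentially" by (simp add: L1_norm_def)
    have "(\<lambda>n. (1 / 2 :: real) ^ n) \<longlonglongrightarrow> 0" by (rule LIMSEQ_power_zero) (simp add: norm_divide)
    then have "(\<lambda>n. C * (2 * (1 / 2) ^ n)) \<longlonglongrightarrow> C * (2 * 0)" by (intro tendsto_mult tendsto_const)
    then show "(\<lambda>n. C * (2 * (1 / 2) ^ n)) \<longlonglongrightarrow> 0" by simp
  qed
  then show ?thesis using L1_limit_simple_functions(1)[OF g s int lim0] by blast
qed

text \<open>Finite nets at radius \<open>(1 / 2) ^ n\<close> make an ultrafilter on the closure
  single out a centre \<open>h n\<close> near almost all its points. These centres converge fast,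
  and the ultrafilter converges to their limit.\<close>

lemma relatively_compactin_L1_normI:
  fixes K :: "('a \<Rightarrow> 'e::banach) set"
  assumes K: "K \<subseteq> L1_space M"
    and net: "\<And>\<epsilon>. \<epsilon> > 0 \<Longrightarrow> \<exists>H. finite H \<and> (\<forall>h\<in>H. simple_function M h) \<and> (\<forall>f\<in>K. \<exists>h\<in>H. L1_norm M (\<lambda>x. f x - h x) < \<epsilon>)"
  shows "relatively_compactin (L1_norm_topology M) K"
proof -
  let ?T = "L1_norm_topology M :: ('a \<Rightarrow> 'e) topology"
  define C where "C = ?T closure_of K"
  have C: "C \<subseteq> L1_space M"
    unfolding C_def using closure_of_subset_topspace[of ?T K] by (simp add: topspace_L1_norm_topology)
  \<comment> \<open>Points of the closure are within \<epsilon>/2 of \<open>K\<close>, so the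
    centres of an \<epsilon>/2-net of \<open>K\<close> also serve the closure.\<close>
  have netC: "\<exists>H. finite H \<and> (\<forall>h\<in>H. simple_function M h) \<and> (\<forall>f\<in>C. \<exists>h\<in>H. L1_norm M (\<lambda>x. f x - h x) < \<epsilon>)"
    if \<epsilon>: "\<epsilon> > 0" for \<epsilon>
  proof -
    obtain H where H: "finite H" "\<forall>h\<in>H. simple_function M h" "\<forall>f\<in>K. \<exists>h\<in>H. L1_norm M (\<lambda>x. f x - h x) < \<epsilon> / 2"
      using net[of "\<epsilon> / 2"] \<epsilon> by auto
    have "\<exists>h\<in>H. L1_norm M (\<lambda>x. g x - h x) < \<epsilon>" if g: "g \<in> C" for g
    proof -
      have gL: "g \<in> L1_space M" using g C by blast
      let ?V = "{f \<in> L1_space M. L1_norm M (\<lambda>x. f x - g x) < \<epsilon> / 2}"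
      have "openin ?T ?V" by (rule openin_L1_ball[OF gL]) (use \<epsilon> in simp)
      moreover have "g \<in> ?V" using gL \<epsilon> by (simp add: L1_norm_zero)
      ultimately obtain f where f: "f \<in> K" "f \<in> ?V"
        using g[unfolded C_def in_closure_of, THEN conjunct2, THEN spec, of ?V] by auto
      obtain h where h: "h \<in> H" "L1_norm M (\<lambda>x. f x - h x) < \<epsilon> / 2" using H(3) f(1) by blast
      have "L1_norm M (\<lambda>x. g x - h x) \<le> L1_norm M (\<lambda>x. g x - f x) + L1_norm M (\<lambda>x. f x - h x)"
        using L1_norm_triangle[OF gL, of f h] f h(1) H(2) L1_simple_function(1) by blast
      also have "\<dots> < \<epsilon>" using f(2) h(2) L1_norm_commute[of g f] by simp
      finally show ?thesis using h(1) by blast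
    qed
    then show ?thesis using H(1,2) by blast
  qed
  have "compactin ?T C"
  proof (rule compactin_ultrafilterI)
    show "C \<subseteq> topspace ?T" using C by (simp add: topspace_L1_norm_topology)
    fix U assume U: "ultrafilter U" "eventually (\<lambda>f. f \<in> C) U"
    have near: "\<exists>h. simple_function M h \<and> eventually (\<lambda>f. L1_norm M (\<lambda>x. f x - h x) < \<epsilon>) U" if "\<epsilon> > 0" for \<epsilon>
    proof -
      obtain H where H: "finite H" "\<forall>h\<in>H. simple_function M h" "\<forall>f\<in>C. \<exists>h\<in>H. L1_norm M (\<lambda>x. f x - h x) < \<epsilon>"
        using netC[OF \<open>\<epsilon> > 0\<close>] by blast
      have "eventually (\<lambda>f. \<exists>h\<in>H. L1_norm M (\<lambda>x. f x - h x) < \<epsilon>) U"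
        using U(2) by eventually_elim (use H(3) in blast)
      then show ?thesis
        using ultrafilter_finite_exD[OF U(1) H(1), of "\<lambda>h f. L1_norm M (\<lambda>x. f x - h x) < \<epsilon>"] H(2) by blast
    qed
    have "\<forall>n. \<exists>h. simple_function M h \<and> eventually (\<lambda>f. L1_norm M (\<lambda>x. f x - h x) < (1 / 2) ^ n) U"
      using near by simp
    then have "\<exists>h. \<forall>n. simple_function M (h n) \<and> eventually (\<lambda>f. L1_norm M (\<lambda>x. f x - h n x) < (1 / 2) ^ n) U"
      by (rule choice)
    then obtain h where h: "\<And>n. simple_function M (h n)"
      "\<And>n. eventually (\<lambda>f. L1_norm M (\<lambda>x. f x - h n x) < (1 / 2) ^ n) U" by blast
    note hL = L1_simple_function(1)[OF h(1)]
    have ex: "\<exists>f. P f" if "eventually P U" for P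
      using that U(1) unfolding ultrafilter_def by (metis eventually_happens)
    \<comment> \<open>Two eventual conditions share a witness \<open>f\<close>, through which
      consecutive centres are compared; \<open>(1 / 2) ^ n + (1 / 2) ^ Suc n\<close> is below the
      bound stated.\<close>
    have "L1_norm M (\<lambda>x. h (Suc n) x - h n x) \<le> 2 * (1 / 2) ^ n" for n
    proof -
      have "eventually (\<lambda>f. f \<in> C \<and> L1_norm M (\<lambda>x. f x - h n x) < (1 / 2) ^ n \<and> L1_norm M (\<lambda>x. f x - h (Suc n) x) < (1 / 2) ^ Suc n) U"
        using h(2) U(2) by (intro eventually_conj)
      then obtain f where f: "f \<in> C" "L1_norm M (\<lambda>x. f x - h n x) < (1 / 2) ^ n" "L1_norm M (\<lambda>x. f x - h (Suc n) x) < (1 / 2) ^ Suc n"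
        using ex by blast
      have "L1_norm M (\<lambda>x. h (Suc n) x - h n x) \<le> L1_norm M (\<lambda>x. h (Suc n) x - f x) + L1_norm M (\<lambda>x. f x - h n x)"
        using f(1) C by (intro L1_norm_triangle hL) auto
      also have "\<dots> \<le> 2 * (1 / 2) ^ n"
      proof -
        have "0 \<le> (1 / 2 :: real) ^ n" by simp
        then show ?thesis using f(2,3) L1_norm_commute[of "h (Suc n)" f] unfolding power_Suc by linarith
      qed
      finally show ?thesis .
    qed
    then obtain g where g: "g \<in> L1_space M" "(\<lambda>n. L1_norm M (\<lambda>x. g x - h n x)) \<longlonglongrightarrow> 0"
      using L1_complete_simple[of h 2] h(1) by blast
    have conv: "eventually (\<lambda>f. f \<in> V) U" if V: "openin ?T V" "g \<in> V" for V
    proof -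
      obtain r where r: "r > 0" "\<forall>f\<in>L1_space M. L1_norm M (\<lambda>x. f x - g x) < r \<longrightarrow> f \<in> V"
        using V unfolding openin_L1_norm_topology by blast
      have "eventually (\<lambda>n. L1_norm M (\<lambda>x. g x - h n x) < r / 2) sequentially"
        using r(1) by (intro order_tendstoD(2)[OF g(2)]) simp
      moreover have "eventually (\<lambda>n. (1 / 2 :: real) ^ n < r / 2) sequentially"
        using r(1) by (intro order_tendstoD(2)[OF LIMSEQ_power_zero]) auto
      ultimately have "eventually (\<lambda>n. L1_norm M (\<lambda>x. g x - h n x) < r / 2 \<and> (1 / 2 :: real) ^ n < r / 2) sequentially"
        by (rule eventually_conj)
      then obtain n where n: "L1_norm M (\<lambda>x. g x - h n x) < r / 2" "(1 / 2 :: real) ^ n < r / 2"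
        by (auto simp: eventually_sequentially)
      show ?thesis
        using h(2)[of n] U(2)
      proof eventually_elim
        case (elim f)
        then have f: "f \<in> L1_space M" using C by blast
        have "L1_norm M (\<lambda>x. f x - g x) \<le> L1_norm M (\<lambda>x. f x - h n x) + L1_norm M (\<lambda>x. h n x - g x)"
          by (intro L1_norm_triangle f hL g)
        also have "\<dots> < r" using n elim L1_norm_commute[of "h n" g] by simp
        finally show ?case using r(2) f by blast
      qed
    qed
    have "g \<in> C"
      unfolding C_def in_closure_of topspace_L1_norm_topology
    proof (intro conjI allI impI g(1))
      fix V assume V: "g \<in> V \<and> openin ?T V"
      then have "eventually (\<lambda>f. f \<in> V \<and> f \<in> C) U" using conv U(2) by (intro eventually_conj) auto
      then obtain f where "f \<in> V" "f \<in> C" using ex by blast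
      then show "\<exists>f. f \<in> K \<and> f \<in> V" using V unfolding C_def in_closure_of by blast
    qed
    then show "\<exists>x\<in>C. \<forall>V. openin ?T V \<longrightarrow> x \<in> V \<longrightarrow> eventually (\<lambda>y. y \<in> V) U" using conv by blast
  qed
  then show ?thesis using K by (simp add: relatively_compactin_def C_def topspace_L1_norm_topology)
qed

text \<open>Simple functions are dense, so the \<epsilon>-balls about them already cover the compact
  closure.\<close>

lemma relatively_compactin_L1_normD:
  fixes K :: "('a \<Rightarrow> 'e::banach) set"
  assumes K: "relatively_compactin (L1_norm_topology M) K" and \<epsilon>: "\<epsilon> > 0"
  shows "\<exists>H. finite H \<and> (\<forall>h\<in>H. simple_function M h) \<and> (\<forall>f\<in>K. \<exists>h\<in>H. L1_norm M (\<lambda>x. f x - h x) < \<epsilon>)"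
proof -
  let ?T = "L1_norm_topology M :: ('a \<Rightarrow> 'e) topology"
  let ?b = "\<lambda>h. {f \<in> L1_space M. L1_norm M (\<lambda>x. f x - h x) < \<epsilon>}"
  have sub: "K \<subseteq> ?T closure_of K" and C: "compactin ?T (?T closure_of K)"
    using K closure_of_subset by (auto simp: relatively_compactin_def)
  have "?T closure_of K \<subseteq> \<Union>(?b ` Collect (simple_function M))"
  proof
    fix f assume "f \<in> ?T closure_of K"
    then have f: "f \<in> L1_space M"
      using subsetD[OF closure_of_subset_topspace[of ?T K]] by (simp add: topspace_L1_norm_topology)
    then show "f \<in> \<Union>(?b ` Collect (simple_function M))" using L1_simple_approx[OF f \<epsilon>] by auto
  qed
  moreover have "openin ?T V" if "V \<in> ?b ` Collect (simple_function M)" for V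
    using that openin_L1_ball[OF L1_simple_function(1) \<epsilon>] by auto
  ultimately obtain \<F> where \<F>: "finite \<F>" "\<F> \<subseteq> ?b ` Collect (simple_function M)" "?T closure_of K \<subseteq> \<Union>\<F>"
    using compactinD[OF C, of "?b ` Collect (simple_function M)"] by blast
  then obtain H where "H \<subseteq> Collect (simple_function M)" "finite H" "\<F> = ?b ` H"
    by (meson finite_subset_image)
  then show ?thesis using \<F>(3) sub by (intro exI[of _ H]) blast
qed

section \<open>Consequences of norm compactness: compact means and the Bocce criterion\<close>

lemma relatively_compactin_mean_on:
  fixes K :: "('a \<Rightarrow> 'e::banach) set"
  assumes K: "relatively_compactin (L1_norm_topology M) K" and B: "B \<in> sets M"
  shows "relatively_compactin euclidean {mean_on M B f | f. f \<in> K}"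
proof -
  let ?T = "L1_norm_topology M :: ('a \<Rightarrow> 'e) topology"
  have "continuous_map ?T euclidean (mean_on M B)"
  proof (rule continuous_map_L1_Lipschitz)
    fix f g :: "'a \<Rightarrow> 'e" assume f: "f \<in> L1_space M" and g: "g \<in> L1_space M"
    have "norm (mean_on M B g - mean_on M B f) \<le> (1 / measure M B) * (LINT x:B|M. norm (g x - f x))"
      by (rule norm_mean_on_diff_le[OF g f B])
    also have "\<dots> \<le> (1 / measure M B) * L1_norm M (\<lambda>x. g x - f x)"
      by (intro mult_left_mono set_integral_le_L1_norm L1_diff g f B) simp
    finally show "norm (mean_on M B g - mean_on M B f) \<le> (1 / measure M B) * L1_norm M (\<lambda>x. g x - f x)" .
  qed
  then have c: "compact (mean_on M B ` (?T closure_of K))"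
    using image_compactin[of ?T "?T closure_of K" euclidean "mean_on M B"] K
    by (simp add: relatively_compactin_def)
  have "{mean_on M B f | f. f \<in> K} \<subseteq> mean_on M B ` (?T closure_of K)"
    using K closure_of_subset[of K ?T] by (auto simp: relatively_compactin_def)
  then have "closure {mean_on M B f | f. f \<in> K} \<subseteq> mean_on M B ` (?T closure_of K)"
    by (intro closure_minimal compact_imp_closed c)
  then have "compact (closure {mean_on M B f | f. f \<in> K})"
    using compact_Int_closed[OF c closed_closure, of "{mean_on M B f | f. f \<in> K}"]
    by (simp only: Int_absorb1)
  then show ?thesis by (simp add: relatively_compactin_def)
qed

lemma L1_norm_relatively_compact_imp_Bocce:
  fixes K :: "('a \<Rightarrow> 'e::banach) set"
  assumes K: "relatively_compactin (L1_norm_topology M) K"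
  shows "Bocce_criterion M K"
  unfolding Bocce_criterion_def
proof (intro allI impI ballI)
  fix \<epsilon> :: real and B assume \<epsilon>: "\<epsilon> > 0" and "B \<in> positive_sets M (space M)"
  then have B: "B \<in> sets M" "measure M B > 0" by (auto simp: positive_sets_def)
  have KL: "K \<subseteq> L1_space M" using K by (simp add: relatively_compactin_def topspace_L1_norm_topology)
  obtain H where H: "finite H" "\<And>h. h \<in> H \<Longrightarrow> simple_function M h"
    "\<And>f. f \<in> K \<Longrightarrow> \<exists>h\<in>H. L1_norm M (\<lambda>x. f x - h x) < \<epsilon> * measure M B / 2"
    using relatively_compactin_L1_normD[OF K, of "\<epsilon> * measure M B / 2"] \<epsilon> B by auto
  define A where "A h v = h -` {v} \<inter> B" for h :: "'a \<Rightarrow> 'e" and v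
  \<comment> \<open>The candidates are the level sets inside \<open>B\<close> of the finitely many
    centres; intersecting with \<open>positive_sets M B\<close> discards null ones. The collection
    depends on the net and not on \<open>f\<close>.\<close>
  define \<A> where "\<A> = (\<Union>h\<in>H. A h ` h ` space M) \<inter> positive_sets M B"
  have A_sets: "A h v \<in> sets M" if "h \<in> H" for h v
  proof -
    have "A h v = (h -` {v} \<inter> space M) \<inter> B" using sets.sets_into_space[OF B(1)] by (auto simp: A_def)
    then show ?thesis using simple_functionD(2)[OF H(2)[OF that]] B(1) by auto
  qed
  show "\<exists>\<A>. finite \<A> \<and> \<A> \<subseteq> positive_sets M B \<and> (\<forall>f\<in>K. \<exists>A\<in>\<A>. Bocce_osc M f A < \<epsilon>)"
  proof (intro exI[of _ \<A>] conjI ballI)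
    show "finite \<A>" unfolding \<A>_def using H simple_functionD(1) by blast
    show "\<A> \<subseteq> positive_sets M B" by (simp add: \<A>_def)
    fix f assume f: "f \<in> K"
    then have fL: "f \<in> L1_space M" using KL by blast
    obtain h where h: "h \<in> H" "L1_norm M (\<lambda>x. f x - h x) < \<epsilon> * measure M B / 2" using H(3)[OF f] by blast
    note hL = L1_simple_function(1)[OF H(2)[OF h(1)]]
    show "\<exists>A\<in>\<A>. Bocce_osc M f A < \<epsilon>"
    proof (rule ccontr)
      assume none: "\<not> ?thesis"
      \<comment> \<open>Null level sets are not in \<open>\<A>\<close> but satisfy the inequality
        trivially, so it can be summed over all values of \<open>h\<close>.\<close>
      have ge: "\<epsilon> / 2 * measure M (A h v) \<le> (LINT x:A h v|M. norm (f x - h x))" if v: "v \<in> h ` space M" for v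
      proof (cases "measure M (A h v) = 0")
        case True
        have "0 \<le> (LINT x:A h v|M. norm (f x - h x))"
          unfolding set_lebesgue_integral_def by (intro integral_nonneg_AE) auto
        then show ?thesis using True by simp
      next
        case False
        then have pos: "measure M (A h v) > 0" by (simp add: zero_less_measure_iff)
        then have "A h v \<in> \<A>" using A_sets[OF h(1)] h(1) v by (auto simp: \<A>_def positive_sets_def A_def)
        then have "\<epsilon> \<le> Bocce_osc M f (A h v)" using none by force
        also have "\<dots> \<le> 2 / measure M (A h v) * (LINT x:A h v|M. norm (f x - v))"
          by (rule Bocce_osc_le[OF fL A_sets[OF h(1)] pos])
        also have "(LINT x:A h v|M. norm (f x - v)) = (LINT x:A h v|M. norm (f x - h x))"
          by (intro set_lebesgue_integral_cong[OF A_sets[OF h(1)]]) (auto simp: A_def)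
        finally show ?thesis using pos by (simp add: field_simps)
      qed
      have fin: "finite (h ` space M)" using simple_functionD(1)[OF H(2)[OF h(1)]] .
      have disj: "disjoint_family_on (A h) (h ` space M)" by (auto simp: disjoint_family_on_def A_def)
      have UN: "(\<Union>v\<in>h ` space M. A h v) = B" using sets.sets_into_space[OF B(1)] by (auto simp: A_def)
      have "\<epsilon> / 2 * measure M B = (\<Sum>v\<in>h ` space M. \<epsilon> / 2 * measure M (A h v))"
        using finite_measure_finite_Union[OF fin _ disj] A_sets[OF h(1)] UN
        by (simp add: image_subset_iff sum_distrib_left sum_divide_distrib)
      also have "\<dots> \<le> (\<Sum>v\<in>h ` space M. LINT x:A h v|M. norm (f x - h x))"
        by (intro sum_mono ge)
      also have "\<dots> = (LINT x:B|M. norm (f x - h x))"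
        unfolding UN[symmetric]
        by (intro set_integral_finite_Union[symmetric] fin disj set_integrable_norm_L1_diff fL hL A_sets h)
      also have "\<dots> \<le> L1_norm M (\<lambda>x. f x - h x)" by (intro set_integral_le_L1_norm L1_diff fL hL B)
      finally show False using h(2) by simp
    qed
  qed
qed

section \<open>Weak topologies\<close>

definition L1_pairing :: "('a \<Rightarrow> 'e::banach \<Rightarrow>\<^sub>L real) \<Rightarrow> ('a \<Rightarrow> 'e) \<Rightarrow> real" where
  "L1_pairing b f = (LINT x|M. blinfun_apply (b x) (f x))"

lemma integrable_pairing:
  fixes f :: "'a \<Rightarrow> 'e::banach"
  assumes b: "b \<in> Linf_dual M" and f: "f \<in> L1_space M"
  shows "integrable M (\<lambda>x. blinfun_apply (b x) (f x))"
proof -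
  obtain C where C: "\<And>x. x \<in> space M \<Longrightarrow> norm (b x) \<le> C" using b by (auto simp: Linf_dual_def)
  show ?thesis
  proof (rule Bochner_Integration.integrable_bound)
    show "integrable M (\<lambda>x. C * norm (f x))" using integrable_norm_L1[OF f] by simp
    show "(\<lambda>x. blinfun_apply (b x) (f x)) \<in> borel_measurable M"
      using b by (intro borel_measurable_strongly_pairing strongly_measurable_L1[OF f]) (simp add: Linf_dual_def)
    show "AE x in M. norm (blinfun_apply (b x) (f x)) \<le> norm (C * norm (f x))"
    proof (rule AE_I2)
      fix x assume "x \<in> space M"
      have "norm (blinfun_apply (b x) (f x)) \<le> norm (b x) * norm (f x)" by (rule norm_blinfun)
      also have "\<dots> \<le> C * norm (f x)" using C[OF \<open>x \<in> space M\<close>] by (rule mult_right_mono) simp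
      also have "\<dots> \<le> norm (C * norm (f x))" by simp
      finally show "norm (blinfun_apply (b x) (f x)) \<le> norm (C * norm (f x))" .
    qed
  qed
qed

lemma L1_pairing_in_L1_dual:
  fixes b :: "'a \<Rightarrow> 'e::banach \<Rightarrow>\<^sub>L real"
  assumes b: "b \<in> Linf_dual M"
  shows "L1_pairing b \<in> L1_dual M"
proof -
  note int = integrable_pairing[OF b]
  obtain C where C: "\<And>x. x \<in> space M \<Longrightarrow> norm (b x) \<le> C" using b by (auto simp: Linf_dual_def)
  have "continuous_map (L1_norm_topology M) euclidean (L1_pairing b)"
  proof (rule continuous_map_L1_Lipschitz)
    fix f g :: "'a \<Rightarrow> 'e" assume f: "f \<in> L1_space M" and g: "g \<in> L1_space M"
    have "L1_pairing b g - L1_pairing b f = (LINT x|M. blinfun_apply (b x) (g x - f x))"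
      unfolding L1_pairing_def using int[OF f] int[OF g] by (simp add: blinfun.diff_right)
    also have "norm \<dots> \<le> (LINT x|M. norm (blinfun_apply (b x) (g x - f x)))"
      by (rule integral_norm_bound)
    also have "\<dots> \<le> (LINT x|M. C * norm (g x - f x))"
    proof (rule integral_mono)
      show "integrable M (\<lambda>x. norm (blinfun_apply (b x) (g x - f x)))"
        by (intro integrable_norm int L1_diff f g)
      show "integrable M (\<lambda>x. C * norm (g x - f x))" using integrable_norm_L1_diff[OF g f] by simp
      fix x assume "x \<in> space M"
      have "norm (blinfun_apply (b x) (g x - f x)) \<le> norm (b x) * norm (g x - f x)" by (rule norm_blinfun)
      also have "\<dots> \<le> C * norm (g x - f x)" using C[OF \<open>x \<in> space M\<close>] by (rule mult_right_mono) simp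
      finally show "norm (blinfun_apply (b x) (g x - f x)) \<le> C * norm (g x - f x)" .
    qed
    finally show "norm (L1_pairing b g - L1_pairing b f) \<le> C * L1_norm M (\<lambda>x. g x - f x)"
      by (simp add: L1_norm_def)
  qed
  then show ?thesis
    using int by (simp add: L1_dual_def L1_pairing_def blinfun.add_right blinfun.scaleR_right)
qed

section \<open>Comparison of the norm, weak and \<open>\<sigma>\<close>-topologies\<close>

lemma L1_sigma_topology_eq:
  "L1_sigma_topology M = induced_topology (L1_space M) (L1_pairing ` Linf_dual M)"
  unfolding L1_sigma_topology_def L1_pairing_def by (simp add: setcompr_eq_image)

lemma zero_in_Linf_dual: "(\<lambda>x. 0) \<in> Linf_dual M"
  by (auto simp: Linf_dual_def intro!: strongly_measurable_simple_function exI[of _ 0])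

lemma L1_dual_nonempty: "L1_dual M \<noteq> {}" and Linf_dual_nonempty: "Linf_dual M \<noteq> {}"
  using L1_pairing_in_L1_dual[OF zero_in_Linf_dual] zero_in_Linf_dual by blast+

lemma L1_norm_compact_imp_weak:
  fixes K :: "('a \<Rightarrow> 'e::banach) set"
  assumes "relatively_compactin (L1_norm_topology M) K"
  shows "relatively_compactin (L1_weak_topology M) K"
  unfolding L1_weak_topology_def
proof (rule relatively_compactin_coarser[OF assms])
  show "openin (L1_norm_topology M) U" if "openin (induced_topology (L1_space M) (L1_dual M)) U"
    for U :: "('a \<Rightarrow> 'e) set"
    using that
    by (intro openin_induced_topology_coarsest[of "L1_dual M" "L1_norm_topology M"])
      (auto simp: L1_dual_def topspace_L1_norm_topology)
qed (simp_all add: regular_space_induced_topology topspace_induced_topology L1_dual_nonempty topspace_L1_norm_topology)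

lemma L1_weak_compact_imp_sigma:
  fixes K :: "('a \<Rightarrow> 'e::banach) set"
  assumes "relatively_compactin (L1_weak_topology M) K"
  shows "relatively_compactin (L1_sigma_topology M) K"
  unfolding L1_sigma_topology_eq
proof (rule relatively_compactin_coarser[OF assms])
  have top: "topspace (L1_weak_topology M :: ('a \<Rightarrow> 'e) topology) = L1_space M"
    by (simp add: L1_weak_topology_def topspace_induced_topology L1_dual_nonempty)
  then show "topspace (induced_topology (L1_space M) (L1_pairing ` Linf_dual M)) = topspace (L1_weak_topology M :: ('a \<Rightarrow> 'e) topology)"
    by (simp add: topspace_induced_topology Linf_dual_nonempty)
  fix U :: "('a \<Rightarrow> 'e) set"
  assume U: "openin (induced_topology (L1_space M) (L1_pairing ` Linf_dual M)) U"
  show "openin (L1_weak_topology M) U"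
  proof (rule openin_induced_topology_coarsest)
    show "openin (induced_topology (topspace (L1_weak_topology M)) (L1_pairing ` Linf_dual M)) U"
      using U top by simp
    fix \<phi> :: "('a \<Rightarrow> 'e) \<Rightarrow> real" assume "\<phi> \<in> L1_pairing ` Linf_dual M"
    then have "\<phi> \<in> L1_dual M" using L1_pairing_in_L1_dual by blast
    then show "continuous_map (L1_weak_topology M) euclideanreal \<phi>"
      unfolding continuous_map_def top
      by (auto simp: L1_weak_topology_def intro: openin_induced_topology)
  qed
qed (simp add: regular_space_induced_topology Linf_dual_nonempty)

lemma L1_sigma_sequence_cluster_point:
  fixes C :: "('a \<Rightarrow> 'e::banach) set"
  assumes C: "compactin (L1_sigma_topology M) C" and f: "\<And>n::nat. f n \<in> C"
  shows "\<exists>g\<in>L1_space M. \<forall>B \<delta>. finite B \<longrightarrow> B \<subseteq> Linf_dual M \<longrightarrow> \<delta> > 0 \<longrightarrow>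
    infinite {n. \<forall>b\<in>B. \<bar>L1_pairing b (f n) - L1_pairing b g\<bar> < \<delta>}"
proof -
  let ?X = "L1_sigma_topology M :: ('a \<Rightarrow> 'e) topology"
  have top: "topspace ?X = L1_space M"
    by (simp add: L1_sigma_topology_eq topspace_induced_topology Linf_dual_nonempty)
  obtain g where g: "g \<in> C" "\<And>V. openin ?X V \<Longrightarrow> g \<in> V \<Longrightarrow> infinite {n. f n \<in> V}"
    using compactin_sequence_cluster_point[of ?X C f, OF C f] by blast
  have CL: "C \<subseteq> L1_space M" using compactin_subset_topspace[OF C] top by simp
  show ?thesis
  proof (intro bexI[of _ g] allI impI)
    show "g \<in> L1_space M" using g(1) CL by blast
    fix B :: "('a \<Rightarrow> 'e \<Rightarrow>\<^sub>L real) set" and \<delta> :: real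
    assume B: "finite B" "B \<subseteq> Linf_dual M" and \<delta>: "\<delta> > 0"
    let ?W = "\<lambda>b. {h \<in> L1_space M. L1_pairing b h \<in> ball (L1_pairing b g) \<delta>}"
    have L1_open: "openin ?X (L1_space M)" using openin_topspace[of ?X] top by simp
    \<comment> \<open>The whole space is inserted so that the intersection is also meaningful and
      open for empty \<open>B\<close>.\<close>
    have "openin ?X (\<Inter> (insert (L1_space M) (?W ` B)))"
    proof (rule openin_Inter)
      show "openin ?X V" if "V \<in> insert (L1_space M) (?W ` B)" for V
        using that B(2) L1_open
        by (auto simp: L1_sigma_topology_eq simp del: mem_ball intro: openin_induced_topology)
    qed (use B in auto)
    then have "infinite {n. f n \<in> \<Inter> (insert (L1_space M) (?W ` B))}"
      using g CL \<delta> by (intro g(2)) auto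
    moreover have "{n. f n \<in> \<Inter> (insert (L1_space M) (?W ` B))} \<subseteq>
        {n. \<forall>b\<in>B. \<bar>L1_pairing b (f n) - L1_pairing b g\<bar> < \<delta>}"
      by (auto simp: dist_real_def abs_minus_commute)
    ultimately show "infinite {n. \<forall>b\<in>B. \<bar>L1_pairing b (f n) - L1_pairing b g\<bar> < \<delta>}"
      using infinite_super by blast
  qed
qed

text \<open>Norming functionals are taken along the values of a simple \<open>s\<close> near
  \<open>f\<close>. Replacing \<open>f\<close> by \<open>s\<close> costs
  \<open>norm (f x - s x)\<close> twice, in the norm and in the pairing, hence the accuracy
  \<epsilon>/2.\<close>

lemma ex_norming_simple_function:
  fixes f :: "'a \<Rightarrow> 'e::banach"
  assumes f: "f \<in> L1_space M" and D: "D \<in> sets M" and \<epsilon>: "\<epsilon> > 0"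
  shows "\<exists>b. simple_function M b \<and> (\<forall>x. norm (b x) \<le> indicator D x) \<and>
    (LINT x:D|M. norm (f x)) - \<epsilon> < L1_pairing b f"
proof -
  obtain s where s: "simple_function M s" "L1_norm M (\<lambda>x. f x - s x) < \<epsilon> / 2"
    using L1_simple_approx[OF f, of "\<epsilon> / 2"] \<epsilon> by auto
  obtain H :: "'e \<Rightarrow> 'e \<Rightarrow>\<^sub>L real" where H: "\<And>v. norm (H v) \<le> 1" "\<And>v. blinfun_apply (H v) v = norm v"
    using ex_norming_functional by metis
  define b where "b x = (if x \<in> D then H (s x) else 0)" for x
  have simple: "simple_function M b"
    unfolding b_def using D by (intro simple_function_If_set simple_function_compose1[OF s(1)]) auto
  have norm_b: "norm (b x) \<le> indicator D x" for x using H(1) by (auto simp: b_def)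
  have "norm (b x) \<le> 1" for x using norm_b[of x] by (auto intro: order_trans split: split_indicator)
  then have b: "b \<in> Linf_dual M"
    using strongly_measurable_simple_function[OF simple] by (auto simp: Linf_dual_def)
  have int1: "integrable M (\<lambda>x. indicator D x *\<^sub>R norm (f x))"
    using D by (intro integrable_mult_indicator integrable_norm_L1 f)
  have int2: "integrable M (\<lambda>x. 2 * norm (f x - s x))"
    using integrable_norm_L1_diff[OF f L1_simple_function(1)[OF s(1)]] by simp
  have "(LINT x:D|M. norm (f x)) - 2 * L1_norm M (\<lambda>x. f x - s x) =
      (LINT x|M. indicator D x *\<^sub>R norm (f x) - 2 * norm (f x - s x))"
    unfolding set_lebesgue_integral_def L1_norm_def using int1 int2 by simp
  also have "\<dots> \<le> L1_pairing b f"
    unfolding L1_pairing_def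
  proof (rule integral_mono)
    show "integrable M (\<lambda>x. indicator D x *\<^sub>R norm (f x) - 2 * norm (f x - s x))"
      by (intro Bochner_Integration.integrable_diff int1 int2)
    show "integrable M (\<lambda>x. blinfun_apply (b x) (f x))" by (rule integrable_pairing[OF b f])
    fix x
    show "indicator D x *\<^sub>R norm (f x) - 2 * norm (f x - s x) \<le> blinfun_apply (b x) (f x)"
    proof (cases "x \<in> D")
      case True
      have "blinfun_apply (b x) (f x) = norm (s x) + blinfun_apply (H (s x)) (f x - s x)"
        using True H(2) by (simp add: b_def blinfun.diff_right)
      moreover have "\<bar>blinfun_apply (H (s x)) (f x - s x)\<bar> \<le> norm (f x - s x)"
        using norm_blinfun[of "H (s x)" "f x - s x"] mult_right_mono[OF H(1), of "norm (f x - s x)" "s x"] by simp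
      moreover have "norm (f x) \<le> norm (s x) + norm (f x - s x)"
        using norm_triangle_sub by blast
      ultimately show ?thesis using True by simp
    next
      case False
      then show ?thesis by (simp add: b_def)
    qed
  qed
  finally have "(LINT x:D|M. norm (f x)) - \<epsilon> < L1_pairing b f" using s(2) by simp
  then show ?thesis using simple norm_b by blast
qed

text \<open>At each point at most one \<open>b i\<close> is nonzero, so for every \<open>J\<close>,
  finite or not, the sum over \<open>J\<close> is bounded by 1. Thus pairing with all
  \<open>b i\<close> maps integrable functions to absolutely summable sequences, and the sum of
  coordinates over \<open>J\<close> is itself a pairing, as the gliding hump requires.\<close>

lemma disjoint_simple_sum_pairing:
  fixes f :: "'a \<Rightarrow> 'e::banach" and b :: "nat \<Rightarrow> 'a \<Rightarrow> 'e \<Rightarrow>\<^sub>L real"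
  assumes D: "\<And>i. D i \<in> sets M" "disjoint_family D"
    and b: "\<And>i. simple_function M (b i)" "\<And>i x. norm (b i x) \<le> indicator (D i) x"
  defines "bs \<equiv> \<lambda>J x. \<Sum>i. indicator J i *\<^sub>R b i x"
  shows "bs J \<in> Linf_dual M"
    and "f \<in> L1_space M \<Longrightarrow> summable (\<lambda>i. \<bar>L1_pairing (b i) f\<bar>)"
    and "f \<in> L1_space M \<Longrightarrow> L1_pairing (bs J) f = (\<Sum>i. indicator J i * L1_pairing (b i) f)"
proof -
  have zero: "b i x = 0" if "x \<notin> D i" for i x using b(2)[of i x] that by simp
  have sums1: "\<exists>i0. \<forall>i. i \<noteq> i0 \<longrightarrow> b i x = 0" for x
  proof (cases "\<exists>i. x \<in> D i")
    case True
    then obtain i0 where "x \<in> D i0" by blast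
    then have "x \<notin> D i" if "i \<noteq> i0" for i using D(2) that by (auto simp: disjoint_family_on_def)
    then show ?thesis using zero by blast
  qed (use zero in blast)
  have le1: "norm (b i x) \<le> 1" for i x
    using b(2)[of i x] by (auto intro: order_trans split: split_indicator)
  have sums: "(\<lambda>i. indicator J i *\<^sub>R b i x) sums bs J x" "norm (bs J x) \<le> 1" for J x
  proof -
    obtain i0 where i0: "\<And>i. i \<noteq> i0 \<Longrightarrow> b i x = 0" using sums1 by blast
    have "(\<Sum>i\<in>{i0}. c i) = c i0" for c :: "nat \<Rightarrow> 'e \<Rightarrow>\<^sub>L real" by simp
    moreover have "(\<lambda>i. indicator J i *\<^sub>R b i x) sums (\<Sum>i\<in>{i0}. indicator J i *\<^sub>R b i x)"
      by (rule sums_finite) (use i0 in auto)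
    ultimately have s: "(\<lambda>i. indicator J i *\<^sub>R b i x) sums (indicator J i0 *\<^sub>R b i0 x)" by (simp only:)
    then show "(\<lambda>i. indicator J i *\<^sub>R b i x) sums bs J x"
      unfolding bs_def by (blast intro: summable_sums sums_summable)
    have "bs J x = indicator J i0 *\<^sub>R b i0 x" using sums_unique[OF s] by (simp add: bs_def)
    then show "norm (bs J x) \<le> 1" using le1[of i0 x] by (auto split: split_indicator)
  qed
  have simple: "simple_function M (\<lambda>x. \<Sum>i<n. indicator J i *\<^sub>R b i x)" for n J
  proof (induction n)
    case (Suc n)
    have "simple_function M (\<lambda>x. indicator J n *\<^sub>R b n x)" by (rule simple_function_compose1[OF b(1)])
    then show ?case using simple_function_compose2[OF Suc, of _ "(+)"] by simp
  qed simp
  have "strongly_measurable M (bs J)"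
    unfolding strongly_measurable_def
    by (intro exI[of _ "\<lambda>n x. \<Sum>i<n. indicator J i *\<^sub>R b i x"]) (use simple sums(1) in \<open>auto simp: sums_def\<close>)
  then show bsJ: "bs J \<in> Linf_dual M" using sums(2) by (auto simp: Linf_dual_def)
  assume f: "f \<in> L1_space M"
  have bL: "b i \<in> Linf_dual M" for i
    using strongly_measurable_simple_function[OF b(1)] le1 by (auto simp: Linf_dual_def)
  have intD: "integrable M (\<lambda>x. indicator (D i) x *\<^sub>R norm (f x))" for i
    using D by (intro integrable_mult_indicator integrable_norm_L1 f)
  \<comment> \<open>Disjointness bounds the masses of \<open>f\<close> on the sets
    \<open>D i\<close> by its seminorm; they dominate the pairings and later justify exchanging sum
    and integral.\<close>
  have "(\<Sum>i<n. LINT x|M. indicator (D i) x *\<^sub>R norm (f x)) \<le> L1_norm M f" for n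
  proof -
    have ind: "(\<Sum>i<n. indicator (D i) x :: real) = indicator (\<Union>i<n. D i) x" for x
      using D(2) by (intro indicator_UN_disjoint[symmetric]) (auto simp: disjoint_family_on_def)
    have "(\<Sum>i<n. LINT x|M. indicator (D i) x *\<^sub>R norm (f x)) = (LINT x|M. (\<Sum>i<n. indicator (D i) x *\<^sub>R norm (f x)))"
      by (rule Bochner_Integration.integral_sum[symmetric]) (rule intD)
    also have "\<dots> = (LINT x:(\<Union>i<n. D i)|M. norm (f x))"
      unfolding set_lebesgue_integral_def scaleR_left.sum[symmetric] ind ..
    also have "\<dots> \<le> L1_norm M f" using D(1) by (intro set_integral_le_L1_norm f) auto
    finally show ?thesis .
  qed
  moreover have "0 \<le> (LINT x|M. indicator (D i) x *\<^sub>R norm (f x))" for i by (intro integral_nonneg_AE) auto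
  ultimately have summD: "summable (\<lambda>i. LINT x|M. indicator (D i) x *\<^sub>R norm (f x))"
    by (intro summableI_nonneg_bounded)
  have pw: "\<bar>blinfun_apply (b i x) (f x)\<bar> \<le> indicator (D i) x *\<^sub>R norm (f x)" for i x
    using norm_blinfun[of "b i x" "f x"] mult_right_mono[OF b(2), of "norm (f x)" i x] by simp
  have int: "integrable M (\<lambda>x. blinfun_apply (b i x) (f x))" for i by (rule integrable_pairing[OF bL f])
  have absint: "(LINT x|M. \<bar>blinfun_apply (b i x) (f x)\<bar>) \<le> (LINT x|M. indicator (D i) x *\<^sub>R norm (f x))" for i
    by (intro integral_mono intD pw integrable_abs int)
  show "summable (\<lambda>i. \<bar>L1_pairing (b i) f\<bar>)"
  proof (rule summable_comparison_test'[OF summD, of 0])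
    fix i
    have "\<bar>L1_pairing (b i) f\<bar> \<le> (LINT x|M. \<bar>blinfun_apply (b i x) (f x)\<bar>)"
      unfolding L1_pairing_def by (rule integral_abs_bound)
    then show "norm \<bar>L1_pairing (b i) f\<bar> \<le> (LINT x|M. indicator (D i) x *\<^sub>R norm (f x))"
      using absint[of i] by simp
  qed
  have "L1_pairing (bs J) f = (LINT x|M. (\<Sum>i. indicator J i * blinfun_apply (b i x) (f x)))"
    unfolding L1_pairing_def
  proof (rule Bochner_Integration.integral_cong[OF refl])
    fix x
    have "(\<lambda>i. blinfun_apply (indicator J i *\<^sub>R b i x) (f x)) sums blinfun_apply (bs J x) (f x)"
      by (rule bounded_linear.sums[OF blinfun.bounded_linear_left sums(1)])
    then show "blinfun_apply (bs J x) (f x) = (\<Sum>i. indicator J i * blinfun_apply (b i x) (f x))"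
      by (simp add: sums_unique blinfun.scaleR_left)
  qed
  also have "\<dots> = (\<Sum>i. LINT x|M. indicator J i * blinfun_apply (b i x) (f x))"
  proof (rule integral_suminf)
    show "integrable M (\<lambda>x. indicator J i * blinfun_apply (b i x) (f x))" for i using int by simp
    show "AE x in M. summable (\<lambda>i. norm (indicator J i * blinfun_apply (b i x) (f x)))"
    proof (rule AE_I2)
      fix x
      obtain i0 where i0: "\<And>i. i \<noteq> i0 \<Longrightarrow> b i x = 0" using sums1 by blast
      show "summable (\<lambda>i. norm (indicator J i * blinfun_apply (b i x) (f x)))"
        by (rule summable_finite[of "{i0}"]) (use i0 in auto)
    qed
    show "summable (\<lambda>i. LINT x|M. norm (indicator J i * blinfun_apply (b i x) (f x)))"
    proof (rule summable_comparison_test'[OF summD, of 0])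
      fix i
      have "(LINT x|M. norm (indicator J i * blinfun_apply (b i x) (f x))) \<le> (LINT x|M. \<bar>blinfun_apply (b i x) (f x)\<bar>)"
        using int by (intro integral_mono) (auto split: split_indicator)
      moreover have "0 \<le> (LINT x|M. norm (indicator J i * blinfun_apply (b i x) (f x)))" by simp
      ultimately show "norm (LINT x|M. norm (indicator J i * blinfun_apply (b i x) (f x))) \<le> (LINT x|M. indicator (D i) x *\<^sub>R norm (f x))"
        using absint[of i] by (simp only: real_norm_def)
    qed
  qed
  also have "\<dots> = (\<Sum>i. indicator J i * L1_pairing (b i) f)" by (simp add: L1_pairing_def)
  finally show "L1_pairing (bs J) f = (\<Sum>i. indicator J i * L1_pairing (b i) f)" .
qed

lemma set_integral_norm_decseq_tendsto_0:
  fixes f :: "'a \<Rightarrow> 'e::banach"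
  assumes f: "f \<in> L1_space M" and R: "range R \<subseteq> sets M" "decseq R" "(\<lambda>n. measure M (R n)) \<longlonglongrightarrow> 0"
  shows "(\<lambda>n. LINT x:R n|M. norm (f x)) \<longlonglongrightarrow> 0"
proof -
  have "(\<lambda>n. measure M (R n)) \<longlonglongrightarrow> measure M (\<Inter>n. R n)"
    using R by (intro finite_Lim_measure_decseq) auto
  then have "measure M (\<Inter>n. R n) = 0" using R(3) LIMSEQ_unique by blast
  then have "(\<Inter>n. R n) \<in> null_sets M" using R(1) by (auto simp: null_sets_def emeasure_eq_measure)
  then have ae: "AE x in M. x \<notin> (\<Inter>n. R n)" by (rule AE_not_in)
  have "(\<lambda>n. LINT x|M. indicator (R n) x *\<^sub>R norm (f x)) \<longlonglongrightarrow> (LINT x|M. 0)"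
  proof (rule integral_dominated_convergence[where w = "\<lambda>x. norm (f x)"])
    show "integrable M (\<lambda>x. norm (f x))" by (rule integrable_norm_L1[OF f])
    show "(\<lambda>x. indicator (R n) x *\<^sub>R norm (f x)) \<in> borel_measurable M" for n
      using R(1) by (intro borel_measurable_integrable integrable_mult_indicator integrable_norm_L1 f) auto
    show "AE x in M. (\<lambda>n. indicator (R n) x *\<^sub>R norm (f x)) \<longlonglongrightarrow> 0"
      using ae
    proof eventually_elim
      case (elim x)
      then obtain N where "x \<notin> R N" by blast
      then have "\<forall>n\<ge>N. indicator (R n) x *\<^sub>R norm (f x) = 0"
        using R(2) by (auto simp: decseq_def indicator_def)
      then show ?case by (intro tendsto_eventually) (auto simp: eventually_sequentially)
    qed
  qed (auto split: split_indicator)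
  then show ?thesis by (simp add: set_lebesgue_integral_def)
qed

lemma L1_sigma_compact_imp_equi_absolutely_continuous:
  fixes K :: "('a \<Rightarrow> 'e::banach) set"
  assumes K: "relatively_compactin (L1_sigma_topology M) K"
  shows "equi_absolutely_continuous K"
  unfolding equi_absolutely_continuous_def
proof (intro allI impI)
  fix R :: "nat \<Rightarrow> 'a set" and \<epsilon> :: real
  assume R: "range R \<subseteq> sets M" "decseq R" "(\<lambda>n. measure M (R n)) \<longlonglongrightarrow> 0" and \<epsilon>: "\<epsilon> > 0"
  let ?X = "L1_sigma_topology M :: ('a \<Rightarrow> 'e) topology"
  define C where "C = ?X closure_of K"
  have C: "compactin ?X C" and KC: "K \<subseteq> C" and KX: "K \<subseteq> topspace ?X"
    using K closure_of_subset by (auto simp: relatively_compactin_def C_def)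
  have KL: "K \<subseteq> L1_space M"
    using KX by (simp add: L1_sigma_topology_eq topspace_induced_topology Linf_dual_nonempty)
  show "\<exists>n. \<forall>f\<in>K. (LINT x:R n|M. norm (f x)) < \<epsilon>"
  proof (rule ccontr)
    assume "\<not> ?thesis"
    then have "\<forall>n. \<exists>f. f \<in> K \<and> \<epsilon> \<le> (LINT x:R n|M. norm (f x))" by (meson not_less)
    then have "\<exists>F. \<forall>n. F n \<in> K \<and> \<epsilon> \<le> (LINT x:R n|M. norm (F n x))" by (rule choice)
    then obtain F where F: "\<And>n. F n \<in> K" "\<And>n. \<epsilon> \<le> (LINT x:R n|M. norm (F n x))" by blast
    have FL: "F n \<in> L1_space M" for n using F(1) KL by blast
    \<comment> \<open>Each single function has an absolutely continuous integral; only uniformity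
      over \<open>K\<close> is in question.\<close>
    have "\<exists>m. n < m \<and> (LINT x:R m|M. norm (F n x)) < \<epsilon> / 2" for n
    proof -
      have "eventually (\<lambda>m. (LINT x:R m|M. norm (F n x)) < \<epsilon> / 2) sequentially"
        using \<epsilon> by (intro order_tendstoD(2)[OF set_integral_norm_decseq_tendsto_0[OF FL R]]) simp
      then have "eventually (\<lambda>m. n < m \<and> (LINT x:R m|M. norm (F n x)) < \<epsilon> / 2) sequentially"
        using eventually_gt_at_top by (rule eventually_conj[rotated])
      then show ?thesis by (auto simp: eventually_sequentially)
    qed
    then have "\<exists>m. \<forall>n. n < m n \<and> (LINT x:R (m n)|M. norm (F n x)) < \<epsilon> / 2" by (intro choice allI)
    then obtain m where m: "\<And>n. n < m n" "\<And>n. (LINT x:R (m n)|M. norm (F n x)) < \<epsilon> / 2" by blast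
    \<comment> \<open>Iterating \<open>m\<close> makes \<open>F (k j)\<close> have mass at least
      \<epsilon> on \<open>R (k j)\<close> and less than \<epsilon>/2 on the next selected set, so
      more than \<epsilon>/2 sits on the difference of the two.\<close>
    define k where "k j = (m ^^ j) 0" for j
    have k_Suc: "k (Suc j) = m (k j)" for j by (simp add: k_def)
    have k_mono: "i \<le> j \<Longrightarrow> k i \<le> k j" for i j
      by (rule lift_Suc_mono_le) (simp_all add: k_Suc m(1) less_imp_le)
    define D where "D j = R (k j) - R (k (Suc j))" for j
    define f where "f j = F (k j)" for j
    have D: "D j \<in> sets M" for j using R(1) by (auto simp: D_def)
    have "D i \<inter> D j = {}" if "i < j" for i j
    proof -
      have "R (k j) \<subseteq> R (k (Suc i))" using R(2) k_mono[of "Suc i" j] that by (auto simp: decseq_def)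
      then show ?thesis by (auto simp: D_def)
    qed
    then have disj: "disjoint_family D"
      unfolding disjoint_family_on_def by (metis Int_commute nat_neq_iff)
    \<comment> \<open>Of the mass \<epsilon>/2 on \<open>D j\<close>, the simple norming function
      may lose \<epsilon>/4, which leaves the bound for the diagonal of the gliding hump.\<close>
    have "\<exists>b. simple_function M b \<and> (\<forall>x. norm (b x) \<le> indicator (D j) x) \<and> \<epsilon> / 4 \<le> L1_pairing b (f j)" for j
    proof -
      have sub: "R (k (Suc j)) \<subseteq> R (k j)" using R(2) k_mono[of j "Suc j"] by (auto simp: decseq_def)
      have int: "set_integrable M A (\<lambda>x. norm (F n x))" if "A \<in> sets M" for A n
        unfolding set_integrable_def using that by (intro integrable_mult_indicator integrable_norm_L1 FL)
      have "(LINT x:R (k j)|M. norm (f j x)) = (LINT x:D j \<union> R (k (Suc j))|M. norm (f j x))"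
        using sub by (simp add: D_def Un_absorb2)
      also have "\<dots> = (LINT x:D j|M. norm (f j x)) + (LINT x:R (k (Suc j))|M. norm (f j x))"
        unfolding f_def using R(1) by (intro set_integral_Un int D) (auto simp: D_def)
      finally have "\<epsilon> / 2 \<le> (LINT x:D j|M. norm (f j x))"
        using F(2)[of "k j"] m(2)[of "k j"] by (simp add: f_def k_Suc)
      moreover obtain b where "simple_function M b" "\<forall>x. norm (b x) \<le> indicator (D j) x"
        "(LINT x:D j|M. norm (f j x)) - \<epsilon> / 4 < L1_pairing b (f j)"
        using ex_norming_simple_function[of "f j" "D j" "\<epsilon> / 4"] FL D \<epsilon> by (auto simp: f_def)
      ultimately show ?thesis by (intro exI[of _ b]) auto
    qed
    then have "\<exists>b. \<forall>j. simple_function M (b j) \<and> (\<forall>x. norm (b j x) \<le> indicator (D j) x) \<and> \<epsilon> / 4 \<le> L1_pairing (b j) (f j)"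
      by (intro choice allI)
    then obtain b where b: "\<And>j. simple_function M (b j)" "\<And>j x. norm (b j x) \<le> indicator (D j) x"
      "\<And>j. \<epsilon> / 4 \<le> L1_pairing (b j) (f j)" by blast
    note pairing = disjoint_simple_sum_pairing[OF D disj b(1,2)]
    define bs where "bs J x = (\<Sum>i. indicator J i *\<^sub>R b i x)" for J x
    have bs: "bs J \<in> Linf_dual M" for J using pairing(1)[of J] by (simp add: bs_def[abs_def])
    have bs_eq: "L1_pairing (bs J) g = (\<Sum>i. indicator J i * L1_pairing (b i) g)" if "g \<in> L1_space M" for J g
      using pairing(3)[OF that, of J] by (simp add: bs_def[abs_def])
    have "\<exists>j. L1_pairing (b j) (f j) < \<epsilon> / 4"
    proof (rule gliding_hump[where y = "\<lambda>j i. L1_pairing (b i) (f j)"])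
      show "summable (\<lambda>i. \<bar>L1_pairing (b i) (f j)\<bar>)" for j
        by (rule pairing(2)) (simp add: f_def FL)
      show "\<epsilon> / 4 > 0" using \<epsilon> by simp
      fix l :: "nat \<Rightarrow> nat"
      have "f (l j) \<in> C" for j using F(1) KC by (auto simp: f_def)
      then obtain g where g: "g \<in> L1_space M" "\<And>B \<delta>. finite B \<Longrightarrow> B \<subseteq> Linf_dual M \<Longrightarrow> \<delta> > 0 \<Longrightarrow>
          infinite {j. \<forall>b\<in>B. \<bar>L1_pairing b (f (l j)) - L1_pairing b g\<bar> < \<delta>}"
        using L1_sigma_sequence_cluster_point[OF C, of "\<lambda>j. f (l j)"] by blast
      show "\<exists>z. summable (\<lambda>i. \<bar>z i\<bar>) \<and> (\<forall>\<J> \<delta>. finite \<J> \<longrightarrow> \<delta> > 0 \<longrightarrow>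
          infinite {j. \<forall>J\<in>\<J>. \<bar>(\<Sum>i. indicator J i * L1_pairing (b i) (f (l j))) - (\<Sum>i. indicator J i * z i)\<bar> < \<delta>})"
      proof (intro exI[of _ "\<lambda>i. L1_pairing (b i) g"] conjI allI impI)
        show "summable (\<lambda>i. \<bar>L1_pairing (b i) g\<bar>)" by (rule pairing(2)[OF g(1)])
        fix \<J> :: "nat set set" and \<delta> :: real assume "finite \<J>" "\<delta> > 0"
        \<comment> \<open>Finitely many index sets correspond to finitely many functionals
          \<open>bs J\<close>, which is what a neighbourhood of \<open>g\<close> can
          control.\<close>
        then have "infinite {j. \<forall>b\<in>bs ` \<J>. \<bar>L1_pairing b (f (l j)) - L1_pairing b g\<bar> < \<delta>}"
          using bs by (intro g(2)) auto
        then show "infinite {j. \<forall>J\<in>\<J>. \<bar>(\<Sum>i. indicator J i * L1_pairing (b i) (f (l j))) - (\<Sum>i. indicator J i * L1_pairing (b i) g)\<bar> < \<delta>}"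
          using bs_eq[OF g(1)] bs_eq[OF FL] by (simp add: f_def)
      qed
    qed
    then show False using b(3) by (meson not_less)
  qed
qed

lemma L1_norm_compactI:
  fixes K :: "('a \<Rightarrow> 'e::banach) set"
  assumes K: "K \<subseteq> L1_space M" and sigma: "relatively_compactin (L1_sigma_topology M) K"
    and bocce: "Bocce_criterion M K"
    and means: "\<forall>B\<in>positive_sets M (space M). relatively_compactin euclidean {mean_on M B f | f. f \<in> K}"
  shows "relatively_compactin (L1_norm_topology M) K"
  using ex_finite_simple_function_net[OF K bocce L1_sigma_compact_imp_equi_absolutely_continuous[OF sigma]] means
  by (intro relatively_compactin_L1_normI[OF K]) blast

end

theorem theorem2p4:
  fixes M :: "'a measure" and K :: "('a \<Rightarrow> 'e::banach) set"
  assumes "prob_space M"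
    and "K \<subseteq> L1_space M"
  shows
    "(relatively_compactin (L1_norm_topology M) K \<longleftrightarrow>
        relatively_compactin (L1_weak_topology M) K \<and>
        Bocce_criterion M K \<and>
        (\<forall>B\<in>positive_sets M (space M). relatively_compactin euclidean {mean_on M B f | f. f \<in> K})) \<and>
     (relatively_compactin (L1_norm_topology M) K \<longleftrightarrow>
        relatively_compactin (L1_sigma_topology M) K \<and>
        Bocce_criterion M K \<and>
        (\<forall>B\<in>positive_sets M (space M). relatively_compactin euclidean {mean_on M B f | f. f \<in> K}))"
proof -
  interpret prob_space M by fact
  have means: "\<forall>B\<in>positive_sets M (space M). relatively_compactin euclidean {mean_on M B f | f. f \<in> K}"
    if "relatively_compactin (L1_norm_topology M) K"
    using relatively_compactin_mean_on[OF that] by (auto simp: positive_sets_def)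
  show ?thesis
    using L1_norm_compact_imp_weak[of K] L1_weak_compact_imp_sigma[of K] means
      L1_norm_relatively_compact_imp_Bocce[of K] L1_norm_compactI[OF assms(2)] by blast
qed

end
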